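(* Let $d\ge 2$, $L\in\mathbb{N}$, and let $\langle\cdot\rangle_L$ be an ensemble of uniformly elliptic symmetric coefficient fields $\mathbb{A}$ on the torus $[0,L)^d$ that is stationary and invariant under the group $\mathcal{G}$, in the sense that for every $R\in\mathcal{G}$ the fields $x\mapsto R^t\mathbb{A}(Rx)R$ and $\mathbb{A}$ have the same distribution under $\langle\cdot\rangle_L$. Let $X$ be a finite-dimensional space of functions on the torus $[0,L)^d$ with square-integrable gradients such that $\psi\in X$ implies $\psi(R\,\cdot)\in X$ for every $R\in\mathcal{G}$. Let $\bar{\mathbb{A}}_L=\bar{\mathbb{A}}_L(\mathbb{A})$ be the associated (random) $d\times d$ matrix and consider the four-linear form $$\bar Q_L(\eta,\xi,\eta',\xi') := L^d\,\mathrm{cov}_{\langle\cdot\rangle_L}\big[\eta\cdot\bar{\mathbb{A}}_L\xi,\ \eta'\cdot\bar{\mathbb{A}}_L\xi'\big],\qquad \eta,\xi,\eta',\xi'\in\mathbb{R}^d.$$ Then for all $R\in\mathcal{G}$ and all $\eta,\xi,\eta',\xi'\in\mathbb{R}^d$, $$\bar Q_L(R\eta,R\xi,R\eta',R\xi')=\bar Q_L(\eta,\xi,\eta',\xi').$$ In the case $d=2$, with $e_1,e_2$ the standard unit vectors, $\bar Q_L$ is characterized by just three numbers, namely $$\bar Q_L(e_1,e_1,e_1,e_2)=\bar Q_L(e_1,e_1,e_2,e_1)=\bar Q_L(e_1,e_2,e_1,e_1)=\bar Q_L(e_2,e_1,e_1,e_1)=0,$$ $$\bar Q_L(e_1,e_2,e_2,e_2)=\bar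 Q_L(e_2,e_1,e_2,e_2)=\bar Q_L(e_2,e_2,e_1,e_2)=\bar Q_L(e_2,e_2,e_2,e_1)=0,$$ $$\bar Q_L(e_1,e_2,e_1,e_2)=\bar Q_L(e_1,e_2,e_2,e_1)=\bar Q_L(e_2,e_1,e_1,e_2)=\bar Q_L(e_2,e_1,e_2,e_1),$$ $$\bar Q_L(e_1,e_1,e_2,e_2)=\bar Q_L(e_2,e_2,e_1,e_1),$$ $$\bar Q_L(e_1,e_1,e_1,e_1)=\bar Q_L(e_2,e_2,e_2,e_2).$$
   Context: The torus $[0,L)^d$ is $\mathbb{R}^d$ modulo $L\mathbb{Z}^d$; functions on it are identified with functions on $\mathbb{R}^d$ that are $L$-periodic in each Cartesian argument. An ensemble $\langle\cdot\rangle_L$ of uniformly elliptic symmetric coefficient fields is a probability distribution (with expectation also denoted $\langle\cdot\rangle_L$) on measurable fields $\mathbb{A}$ of symmetric $d\times d$ matrices on the torus satisfying $\alpha_0 I\le\mathbb{A}(x)\le\beta_0 I$ for fixed constants $0<\alpha_0\le\beta_0<\infty$. Stationary means the distribution is invariant under translations of the torus. $\mathcal{G}$ is the group of all orthogonal transformations of $\mathbb{R}^d$ that leave the (hyper-)cube invariant; it is generated by the rotations in the Cartesian two-dimensional planes preserving the cube and the reflections along Cartesian hyperplanes (equivalently, the signed permutation matrices), and it acts on the torus by $x\mapsto Rx$ modulo $L\mathbb{Z}^d$. $R^t$ is the transpose of $R$. For a realization $\mathbb{A}$ and $i=1,\dots,d$, let $e_i$ be the unit vector in direction $i$ and let $\phi_i\in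 X$ be defined (uniquely up to additive constants, so that $\nabla\phi_i$ is unique) by $$\int_{[0,L)^d}\nabla\psi\cdot\mathbb{A}(e_i+\nabla\phi_i)\,dx=0\quad\text{for all }\psi\in X.$$ The matrix $\bar{\mathbb{A}}_L=[\bar a_{L,ij}]$ is defined by $$\bar a_{L,ij}:=e_j\cdot\int_{[0,L)^d}\mathbb{A}(e_i+\nabla\phi_i)\,dx .$$ For random variables $U,V$, $\mathrm{cov}_{\langle\cdot\rangle_L}[U,V]:=\langle(U-\langle U\rangle_L)(V-\langle V\rangle_L)\rangle_L$. *)

theory Defs
  imports "HOL-Probability.Probability"
begin

definition cell :: "nat \<Rightarrow> (real^'d) set"
  where "cell L = {x. \<forall>i. 0 \<le> x $ i \<and> x $ i < real L}"

definition periodic :: "nat \<Rightarrow> (real^'d \<Rightarrow> 'b) \<Rightarrow> bool"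
  where "periodic L f \<longleftrightarrow> (\<forall>x i. f (x + axis i (real L)) = f x)"

text \<open>The cube left invariant is the one centred at the origin; its side length is irrelevant
  because the elements of the group are linear.\<close>

definition cube_group :: "(real^'d^'d) set"
  where "cube_group =
    {R. orthogonal_matrix R \<and> (\<lambda>x. R *v x) ` cbox (- 1) 1 = cbox (- 1) (1 :: real^'d)}"

text \<open>Weak gradient on the torus, tested with continuously differentiable periodic functions
  (the same notion as with smooth periodic test functions).\<close>

definition has_weak_gradient :: "nat \<Rightarrow> (real^'d \<Rightarrow> real) \<Rightarrow> (real^'d \<Rightarrow> real^'d) \<Rightarrow> bool"
  where "has_weak_gradient L \<psi> g \<longleftrightarrow>
    periodic L \<psi> \<and> set_integrable lebesgue (cell L) \<psi> \<and>
    periodic L g \<and> set_integrable lebesgue (cell L) g \<and>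
    (\<forall>\<zeta> \<zeta>'. periodic L \<zeta> \<longrightarrow> (\<forall>x. GDERIV \<zeta> x :> \<zeta>' x) \<longrightarrow> continuous_on UNIV \<zeta>' \<longrightarrow>
      (LINT x:cell L|lebesgue. \<psi> x *\<^sub>R \<zeta>' x) = - (LINT x:cell L|lebesgue. \<zeta> x *\<^sub>R g x))"

definition torus_H1 :: "nat \<Rightarrow> (real^'d \<Rightarrow> real) set"
  where "torus_H1 L =
    {\<psi>. \<exists>g. has_weak_gradient L \<psi> g \<and> set_integrable lebesgue (cell L) (\<lambda>x. (norm (g x))\<^sup>2)}"

text \<open>The weak gradient is unique up to null sets, and is used below only under integrals over
  the cell.\<close>

definition weak_gradient :: "nat \<Rightarrow> (real^'d \<Rightarrow> real) \<Rightarrow> real^'d \<Rightarrow> real^'d"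
  where "weak_gradient L \<psi> = (SOME g. has_weak_gradient L \<psi> g)"

text \<open>Finite dimension is required up to almost everywhere equality. This admits both
  finite-dimensional spaces of genuine functions and finite-dimensional spaces of equivalence
  classes, the latter given as the set of all their representatives.\<close>

definition finite_dim_torus_space :: "nat \<Rightarrow> (real^'d \<Rightarrow> real) set \<Rightarrow> bool"
  where "finite_dim_torus_space L X \<longleftrightarrow>
    X \<subseteq> torus_H1 L \<and>
    (\<lambda>x. 0) \<in> X \<and>
    (\<forall>\<phi>\<in>X. \<forall>\<psi>\<in>X. (\<lambda>x. \<phi> x + \<psi> x) \<in> X) \<and>
    (\<forall>c. \<forall>\<psi>\<in>X. (\<lambda>x. c * \<psi> x) \<in> X) \<and>
    (\<exists>B. finite B \<and> B \<subseteq> X \<and>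
      (\<forall>\<psi>\<in>X. \<exists>c. AE x in lebesgue. \<psi> x = (\<Sum>b\<in>B. c b * b x)))"

definition coeff_fields :: "nat \<Rightarrow> real \<Rightarrow> real \<Rightarrow> (real^'d \<Rightarrow> real^'d^'d) set"
  where "coeff_fields L \<alpha>\<^sub>0 \<beta>\<^sub>0 =
    {A. periodic L A \<and> A \<in> borel_measurable lebesgue \<and>
        (\<forall>x. transpose (A x) = A x \<and>
             (\<forall>\<xi>. \<alpha>\<^sub>0 * (\<xi> \<bullet> \<xi>) \<le> \<xi> \<bullet> (A x *v \<xi>) \<and> \<xi> \<bullet> (A x *v \<xi>) \<le> \<beta>\<^sub>0 * (\<xi> \<bullet> \<xi>)))}"

text \<open>The space of coefficient fields carries the coarsest \<open>\<sigma>\<close>-algebra for which all spatial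
  averages of the entries against integrable weights are measurable.\<close>

definition coeff_space :: "nat \<Rightarrow> real \<Rightarrow> real \<Rightarrow> (real^'d \<Rightarrow> real^'d^'d) measure"
  where "coeff_space L \<alpha>\<^sub>0 \<beta>\<^sub>0 = sigma (coeff_fields L \<alpha>\<^sub>0 \<beta>\<^sub>0)
    {{A \<in> coeff_fields L \<alpha>\<^sub>0 \<beta>\<^sub>0. (LINT x:cell L|lebesgue. w x * A x $ i $ j) \<in> S} | w i j S.
      set_integrable lebesgue (cell L) w \<and> S \<in> sets borel}"

definition ensemble ::
    "nat \<Rightarrow> real \<Rightarrow> real \<Rightarrow> (real^'d \<Rightarrow> real^'d^'d) measure \<Rightarrow> bool"
  where "ensemble L \<alpha>\<^sub>0 \<beta>\<^sub>0 M \<longleftrightarrow> prob_space M \<and> sets M = sets (coeff_space L \<alpha>\<^sub>0 \<beta>\<^sub>0)"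

definition stationary :: "(real^'d \<Rightarrow> real^'d^'d) measure \<Rightarrow> bool"
  where "stationary M \<longleftrightarrow> (\<forall>z. distr M M (\<lambda>A x. A (x + z)) = M)"

definition cube_invariant :: "(real^'d \<Rightarrow> real^'d^'d) measure \<Rightarrow> bool"
  where "cube_invariant M \<longleftrightarrow>
    (\<forall>R\<in>cube_group. distr M M (\<lambda>A x. transpose R ** A (R *v x) ** R) = M)"

definition is_corrector ::
    "nat \<Rightarrow> (real^'d \<Rightarrow> real) set \<Rightarrow> (real^'d \<Rightarrow> real^'d^'d) \<Rightarrow> 'd \<Rightarrow> (real^'d \<Rightarrow> real) \<Rightarrow> bool"
  where "is_corrector L X A i \<phi> \<longleftrightarrow> \<phi> \<in> X \<and>
    (\<forall>\<psi>\<in>X. (LINT x:cell L|lebesgue.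
       weak_gradient L \<psi> x \<bullet> (A x *v (axis i 1 + weak_gradient L \<phi> x))) = 0)"

definition corrector ::
    "nat \<Rightarrow> (real^'d \<Rightarrow> real) set \<Rightarrow> (real^'d \<Rightarrow> real^'d^'d) \<Rightarrow> 'd \<Rightarrow> real^'d \<Rightarrow> real"
  where "corrector L X A i = (SOME \<phi>. is_corrector L X A i \<phi>)"

definition Abar ::
    "nat \<Rightarrow> (real^'d \<Rightarrow> real) set \<Rightarrow> (real^'d \<Rightarrow> real^'d^'d) \<Rightarrow> real^'d^'d"
  where "Abar L X A = (\<chi> i j. axis j 1 \<bullet>
    (LINT x:cell L|lebesgue. A x *v (axis i 1 + weak_gradient L (corrector L X A i) x)))"

definition cov :: "'w measure \<Rightarrow> ('w \<Rightarrow> real) \<Rightarrow> ('w \<Rightarrow> real) \<Rightarrow> real"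
  where "cov M U V =
    integral\<^sup>L M (\<lambda>\<omega>. (U \<omega> - integral\<^sup>L M U) * (V \<omega> - integral\<^sup>L M V))"

definition Qbar ::
    "nat \<Rightarrow> (real^'d \<Rightarrow> real^'d^'d) measure \<Rightarrow> (real^'d \<Rightarrow> real) set \<Rightarrow>
     real^'d \<Rightarrow> real^'d \<Rightarrow> real^'d \<Rightarrow> real^'d \<Rightarrow> real"
  where "Qbar L M X \<eta> \<xi> \<eta>' \<xi>' = real L ^ CARD('d) *
    cov M (\<lambda>A. \<eta> \<bullet> (Abar L X A *v \<xi>)) (\<lambda>A. \<eta>' \<bullet> (Abar L X A *v \<xi>'))"

end

theory Submission
  imports Defs
begin

text \<open>For a symmetric field the quadratic form of \<open>Abar\<close> is a minimal energy:
  \<open>\<xi> \<bullet> Abar(A) \<xi>\<close> is the minimum over \<open>\<psi> \<in> X\<close> of the integral of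
  \<open>(\<xi> + \<nabla>\<psi>) \<bullet> A (\<xi> + \<nabla>\<psi>)\<close>. Since \<open>X\<close> is invariant, substituting \<open>\<psi>(R \<cdot>)\<close> shows that
  replacing \<open>A\<close> by \<open>R\<^sup>t A(R \<cdot>) R\<close> replaces \<open>Abar\<close> by \<open>R\<^sup>t Abar R\<close>, and the invariance of the ensemble
  transfers this to the covariances. The same variational formula gives boundedness of \<open>Abar\<close> and,
  through rational coefficients, its measurability; hence \<open>Qbar\<close> is four-linear. In two dimensions
  the symmetry of \<open>Abar\<close>, the reflections and the exchange of the axes leave three coefficients.\<close>

section \<open>The cube group acting on the torus\<close>

text \<open>\<open>weak_gradient\<close> and \<open>corrector\<close> are arbitrary choices: the
  corrector cannot be expected to depend measurably on the field, nor either of them to commute with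
  rotations. The minimal energy does not depend on these choices, and polarization recovers the
  entries of \<open>Abar\<close> from it. Weak gradients are unique only almost everywhere, and this
  rests on the fact that continuously differentiable periodic functions separate integrable fields,
  for which enough test functions have to be constructed. A second obstacle is the cell:
  \<open>R\<close> does not in general map \<open>[0,L)^d\<close> to itself, so integrals are
  transported by the rotation about the centre of the cell, which preserves the cell up to a null
  set and differs from \<open>R\<close> by periods. Finally, \<open>X\<close> is finite-dimensional
  only modulo null sets and may contain constants, so a spanning set can have linearly dependent
  gradients; the correctors come from a projection that tolerates degenerate directions.\<close>

abbreviation torus :: "nat \<Rightarrow> (real^'d) measure"
  where "torus L \<equiv> lebesgue_on (cell L)"

section \<open>Lebesgue measure on the half-open cell\<close>

lemma cell_between:
  "box 0 (real L *\<^sub>R 1) \<subseteq> (cell L :: (real^'d) set)" "(cell L :: (real^'d) set) \<subseteq> cbox 0 (real L *\<^sub>R 1)"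
  by (auto simp: cell_def mem_box_cart less_imp_le)

lemma negligible_cbox_minus_cell: "negligible (cbox 0 (real L *\<^sub>R 1) - (cell L :: (real^'d) set))"
  by (rule negligible_subset[OF negligible_frontier_interval]) (use cell_between in blast)

lemma lmeasurable_cell [simp]: "(cell L :: (real^'d) set) \<in> lmeasurable"
proof -
  have "cell L = cbox 0 (real L *\<^sub>R 1) - (cbox 0 (real L *\<^sub>R 1) - (cell L :: (real^'d) set))"
    using cell_between by blast
  then show ?thesis
    by (metis fmeasurable.Diff lmeasurable_cbox negligible_cbox_minus_cell negligible_iff_measure)
qed

lemma sets_cell [simp]: "(cell L :: (real^'d) set) \<in> sets lebesgue"
  by (simp add: fmeasurableD)

lemma finite_measure_torus: "finite_measure (torus L :: (real^'d) measure)"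
  by (rule finite_measure_lebesgue_on) simp

lemma set_integrable_cell:
  fixes f :: "real^'d \<Rightarrow> 'b::{banach,second_countable_topology}"
  shows "set_integrable lebesgue (cell L) f \<longleftrightarrow> integrable (torus L) f"
  by (rule set_integrable_eq) simp

lemma set_lebesgue_integral_cell:
  fixes f :: "real^'d \<Rightarrow> 'b::{banach,second_countable_topology}"
  shows "(LINT x:cell L|lebesgue. f x) = integral\<^sup>L (torus L) f"
  by (simp add: set_lebesgue_integral_def integral_restrict_space)


text \<open>As a simplification rule it turns \<open>transpose R *v x\<close> into
  \<open>x v* R\<close>, where the transpose is no longer visible as an element of
  \<open>cube_group\<close>.\<close>

declare transpose_matrix_vector [simp del]

section \<open>The cube group as signed permutation matrices\<close>

lemma cube_group_transpose:
  assumes "R \<in> cube_group" shows "transpose R \<in> cube_group"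
proof -
  have o: "orthogonal_matrix R" and im: "(\<lambda>x. R *v x) ` cbox (- 1) 1 = cbox (- 1) 1"
    using assms by (auto simp: cube_group_def)
  have "(\<lambda>x. transpose R *v x) ` cbox (- 1) 1 = (\<lambda>x. transpose R *v x) ` (\<lambda>x. R *v x) ` cbox (- 1) 1"
    by (simp add: im)
  also have "\<dots> = cbox (-1) 1"
    using o by (simp add: image_image matrix_vector_mul_assoc orthogonal_matrix_def)
  finally show ?thesis using o by (simp add: cube_group_def orthogonal_matrix_def)
qed

lemma cube_group_inverse:
  assumes "R \<in> cube_group"
  shows "transpose R ** R = mat 1" "R ** transpose R = mat 1"
  using assms by (auto simp: cube_group_def orthogonal_matrix_def)

lemma cube_group_inverse_apply [simp]:
  assumes "R \<in> cube_group"
  shows "transpose R *v (R *v x) = x" "R *v (transpose R *v x) = x"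
  using cube_group_inverse[OF assms] by (simp_all add: matrix_vector_mul_assoc)

lemma inner_transpose_matrix:
  fixes R :: "real^'n^'m"
  shows "(transpose R *v x) \<bullet> y = x \<bullet> (R *v y)"
  by (simp add: transpose_matrix_vector dot_lmul_matrix)

lemma inner_matrix_transpose:
  fixes R :: "real^'n^'m"
  shows "x \<bullet> (transpose R *v y) = (R *v x) \<bullet> y"
  by (metis inner_commute inner_transpose_matrix)

text \<open>Evaluating row \<open>i\<close> of \<open>R\<close> at the vertex formed by the signs of its entries bounds the sum
  of their absolute values by 1, which is also the sum of their squares.\<close>

lemma cube_group_entry:
  fixes R :: "real^'d^'d"
  assumes R: "R \<in> cube_group" shows "\<bar>R $ i $ j\<bar> \<in> {0, 1}"
proof -
  have sq: "(\<Sum>j\<in>UNIV. (R $ i $ j)\<^sup>2) = 1"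
  proof -
    have "(R ** transpose R) $ i $ i = 1" using cube_group_inverse[OF R] by (simp add: mat_def)
    then show ?thesis by (simp add: matrix_matrix_mult_def transpose_def power2_eq_square)
  qed
  have ab: "(\<Sum>j\<in>UNIV. \<bar>R $ i $ j\<bar>) \<le> 1"
  proof -
    define x :: "real^'d" where "x = (\<chi> j. if R $ i $ j < 0 then -1 else 1)"
    have "x \<in> cbox (- 1) 1" by (auto simp: x_def mem_box_cart)
    then have "R *v x \<in> cbox (- 1) 1" using R by (auto simp: cube_group_def)
    then have "(R *v x) $ i \<le> 1" by (auto simp: mem_box_cart)
    moreover have "(R *v x) $ i = (\<Sum>j\<in>UNIV. \<bar>R $ i $ j\<bar>)"
      unfolding matrix_vector_mult_def x_def by (auto intro!: sum.cong)
    ultimately show ?thesis by simp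
  qed
  have le1: "\<bar>R $ i $ j\<bar> \<le> 1" for j
    using ab member_le_sum[of j UNIV "\<lambda>j. \<bar>R $ i $ j\<bar>"] by simp
  have "(\<Sum>j\<in>UNIV. \<bar>R $ i $ j\<bar> - (R $ i $ j)\<^sup>2) = 0"
  proof (rule antisym)
    show "(\<Sum>j\<in>UNIV. \<bar>R $ i $ j\<bar> - (R $ i $ j)\<^sup>2) \<le> 0" by (simp add: sum_subtractf sq ab)
    show "0 \<le> (\<Sum>j\<in>UNIV. \<bar>R $ i $ j\<bar> - (R $ i $ j)\<^sup>2)"
      using le1 by (intro sum_nonneg) (metis abs_ge_zero abs_power2 diff_ge_0_iff_ge mult_left_le
        power2_abs power2_eq_square)
  qed
  moreover have "\<forall>j\<in>UNIV. 0 \<le> \<bar>R $ i $ j\<bar> - (R $ i $ j)\<^sup>2"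
    using le1 by (metis abs_ge_zero diff_ge_0_iff_ge mult_left_le power2_abs power2_eq_square)
  ultimately have "\<bar>R $ i $ j\<bar> - (R $ i $ j)\<^sup>2 = 0"
    using sum_nonneg_eq_0_iff[of UNIV "\<lambda>j. \<bar>R $ i $ j\<bar> - (R $ i $ j)\<^sup>2"] by auto
  then have "\<bar>R $ i $ j\<bar> * (1 - \<bar>R $ i $ j\<bar>) = 0"
    by (metis eq_iff_diff_eq_0 mult.right_neutral power2_abs power2_eq_square right_diff_distrib)
  then show ?thesis by auto
qed

text \<open>With entries 0, 1 or -1 the squares are the indicators of the nonzero entries, so the
  squared row norm, which is 1, counts them.\<close>

lemma cube_group_row_unique:
  fixes R :: "real^'d^'d"
  assumes R: "R \<in> cube_group" shows "\<exists>!j. R $ i $ j \<noteq> 0"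
proof -
  have "(R ** transpose R) $ i $ i = 1" using cube_group_inverse[OF R] by (simp add: mat_def)
  then have sq: "(\<Sum>j\<in>UNIV. (R $ i $ j)\<^sup>2) = 1"
    by (simp add: matrix_matrix_mult_def transpose_def power2_eq_square)
  have "(R $ i $ j)\<^sup>2 = of_bool (R $ i $ j \<noteq> 0)" for j
    using cube_group_entry[OF R, of i j] by (auto simp: abs_if split: if_splits)
  then have "real (card {j. R $ i $ j \<noteq> 0}) = 1"
    using sq by (simp add: sum.If_cases of_bool_def)
  then have "card {j. R $ i $ j \<noteq> 0} = 1" by linarith
  then obtain j where "{j. R $ i $ j \<noteq> 0} = {j}" by (meson card_1_singletonE)
  then show ?thesis by (intro ex1I[of _ j]) auto
qed

lemma cube_group_signed_permutation:
  fixes R :: "real^'d^'d"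
  assumes R: "R \<in> cube_group"
  obtains p s where "bij p" "\<And>i. s i = 1 \<or> s i = -1" "\<And>x i. (R *v x) $ i = s i * x $ p i"
proof -
  define p where "p i = (THE j. R $ i $ j \<noteq> 0)" for i
  have p: "R $ i $ p i \<noteq> 0" "R $ i $ j \<noteq> 0 \<Longrightarrow> j = p i" for i j
    unfolding p_def using cube_group_row_unique[OF R, of i] theI'[of "\<lambda>j. R $ i $ j \<noteq> 0"] by auto
  \<comment> \<open>Two rows with their nonzero entry in the same column would give the transpose,
    again in the group, a row with two nonzero entries.\<close>
  have "inj p"
  proof (rule injI)
    fix i i' assume "p i = p i'"
    then have "transpose R $ p i $ i \<noteq> 0" "transpose R $ p i $ i' \<noteq> 0"
      using p(1)[of i] p(1)[of i'] by (auto simp: transpose_def)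
    then show "i = i'" using cube_group_row_unique[OF cube_group_transpose[OF R], of "p i"] by auto
  qed
  then have "bij p" by (simp add: bij_def finite_UNIV_inj_surj)
  moreover have "R $ i $ p i = 1 \<or> R $ i $ p i = -1" for i
    using cube_group_entry[OF R, of i "p i"] p(1)[of i] by auto
  moreover have "(R *v x) $ i = R $ i $ p i * x $ p i" for x i
  proof -
    have "(R *v x) $ i = (\<Sum>j\<in>UNIV. if j = p i then R $ i $ j * x $ j else 0)"
      unfolding matrix_vector_mult_def vec_lambda_beta by (rule sum.cong) (use p(2) in auto)
    then show ?thesis by simp
  qed
  ultimately show ?thesis by (rule that)
qed

text \<open>The rotation about the centre of the cell. It agrees with \<open>R\<close> modulo the period lattice and,
  unlike \<open>R\<close>, maps the closed cell onto itself.\<close>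

definition cell_rotation :: "nat \<Rightarrow> real^'d^'d \<Rightarrow> real^'d \<Rightarrow> real^'d"
  where "cell_rotation L R x = (real L / 2) *\<^sub>R 1 + R *v (x - (real L / 2) *\<^sub>R 1)"

lemma cell_rotation_inverse [simp]:
  assumes "R \<in> cube_group"
  shows "cell_rotation L (transpose R) (cell_rotation L R x) = x"
    "cell_rotation L R (cell_rotation L (transpose R) x) = x"
  using assms by (simp_all add: cell_rotation_def)

text \<open>The sign -1 reflects a coordinate at \<open>L / 2\<close>, the coordinate of the centre;
  copying and reflecting both preserve the interval [0, L].\<close>

lemma cell_rotation_component:
  assumes "(R *v (x - (real L / 2) *\<^sub>R 1)) $ i = s * (x - (real L / 2) *\<^sub>R 1) $ j" "s = 1 \<or> s = -1"
  shows "cell_rotation L R x $ i = (if s = 1 then x $ j else real L - x $ j)"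
  using assms by (auto simp: cell_rotation_def)

lemma prod_Basis_cart:
  fixes f :: "real^'d \<Rightarrow> 'a::comm_monoid_mult"
  shows "(\<Prod>b\<in>Basis. f b) = (\<Prod>i\<in>UNIV. f (axis i 1))"
proof -
  have eq: "Basis = range (\<lambda>i. axis i 1 :: real^'d)" by (auto simp: Basis_vec_def)
  have inj: "inj (\<lambda>i. axis i 1 :: real^'d)" by (auto simp: inj_on_def axis_eq_axis)
  show ?thesis by (simp only: eq prod.reindex[OF inj] o_def)
qed

lemma continuous_cell_rotation: "continuous_on S (cell_rotation L R)"
  unfolding cell_rotation_def by (intro continuous_intros bounded_linear.continuous_on[OF matrix_vector_mul_bounded_linear])

text \<open>Lebesgue measure is determined by its values on boxes, and the preimage of a box under a
  signed permutation about a centre is again a box whose side lengths are permuted.\<close>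

lemma distr_lborel_cell_rotation:
  assumes R: "R \<in> cube_group"
  shows "distr lborel borel (cell_rotation L R) = (lborel :: (real^'d) measure)"
proof (rule lborel_eqI[symmetric])
  obtain p s where p: "bij p" and s: "\<And>i. s i = 1 \<or> s i = -1"
    and R_eq: "\<And>x i. (R *v x) $ i = s i * x $ p i"
    using cube_group_signed_permutation[OF R] by metis
  have T: "cell_rotation L R x $ i = (if s i = 1 then x $ p i else real L - x $ p i)" for x i
    by (rule cell_rotation_component[OF R_eq s])
  have [measurable]: "cell_rotation L R \<in> borel_measurable borel"
    by (intro borel_measurable_continuous_onI continuous_cell_rotation)
  fix l u :: "real^'d" assume "\<And>b. b \<in> Basis \<Longrightarrow> l \<bullet> b \<le> u \<bullet> b"
  then have lu: "l $ i \<le> u $ i" for i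
    by (metis axis_in_Basis_iff inner_axis inner_real_def mult.right_neutral Basis_real_def singletonI)
  let ?q = "inv p"
  have q: "p (?q i) = i" "?q (p i) = i" for i
    using p by (simp_all add: bij_inv_eq_iff bij_is_inj surj_f_inv_f bij_is_surj)
  \<comment> \<open>Coordinate \<open>j\<close> of the argument feeds component
    \<open>inv p j\<close> of the image. A reflection there exchanges the two bounds and replaces
    each t by L - t.\<close>
  define l' u' :: "real^'d"
    where "l' = (\<chi> j. if s (?q j) = 1 then l $ ?q j else real L - u $ ?q j)"
      and "u' = (\<chi> j. if s (?q j) = 1 then u $ ?q j else real L - l $ ?q j)"
  have "x \<in> cell_rotation L R -` box l u \<longleftrightarrow> x \<in> box l' u'" for x
  proof -
    have "x \<in> cell_rotation L R -` box l u \<longleftrightarrow> (\<forall>i. l $ i < cell_rotation L R x $ i \<and> cell_rotation L R x $ i < u $ i)"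
      by (simp add: mem_box_cart)
    also have "\<dots> \<longleftrightarrow> (\<forall>i. l' $ p i < x $ p i \<and> x $ p i < u' $ p i)"
      by (intro all_cong1) (auto simp: T l'_def u'_def q)
    also have "\<dots> \<longleftrightarrow> (\<forall>j. l' $ j < x $ j \<and> x $ j < u' $ j)" using q by metis
    finally show ?thesis by (simp add: mem_box_cart)
  qed
  then have "cell_rotation L R -` box l u = box l' u'" by blast
  then have "emeasure (distr lborel borel (cell_rotation L R)) (box l u) = emeasure lborel (box l' u')"
    by (simp add: emeasure_distr)
  also have "\<dots> = (\<Prod>b\<in>Basis. (u' - l') \<bullet> b)"
  proof -
    have "l' \<bullet> b \<le> u' \<bullet> b" if "b \<in> Basis" for b
      using that lu by (auto simp: Basis_vec_def inner_axis l'_def u'_def)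
    then show ?thesis by (simp add: emeasure_lborel_box)
  qed
  also have "(\<Prod>b\<in>Basis. (u' - l') \<bullet> b) = (\<Prod>j\<in>UNIV. (u - l) $ ?q j)"
    by (auto simp: prod_Basis_cart inner_axis l'_def u'_def intro!: prod.cong)
  also have "\<dots> = (\<Prod>i\<in>UNIV. (u - l) $ i)"
    by (rule prod.reindex_bij_betw[OF bij_imp_bij_inv[OF p]])
  also have "\<dots> = (\<Prod>b\<in>Basis. (u - l) \<bullet> b)"
    by (simp add: prod_Basis_cart inner_axis)
  finally show "emeasure (distr lborel borel (cell_rotation L R)) (box l u) = (\<Prod>b\<in>Basis. (u - l) \<bullet> b)" .
qed simp

text \<open>Lebesgue sets are Borel sets up to null sets, so Borel measurability of the rotation is
  not enough: preimages of null sets must be null, which follows from the preservation of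
  \<open>lborel\<close>.\<close>

lemma
  fixes R :: "real^'d^'d"
  assumes R: "R \<in> cube_group"
  shows measurable_cell_rotation: "cell_rotation L R \<in> lebesgue \<rightarrow>\<^sub>M lebesgue"
    and distr_lebesgue_cell_rotation: "distr lebesgue lebesgue (cell_rotation L R) = lebesgue"
proof -
  have T[measurable]: "cell_rotation L R \<in> borel_measurable borel"
    by (intro borel_measurable_continuous_onI continuous_cell_rotation)
  have T': "cell_rotation L R \<in> lborel \<rightarrow>\<^sub>M lborel" by simp
  have eq: "distr lebesgue lborel (cell_rotation L R) = lborel"
    using distr_completion[OF T'] distr_lborel_cell_rotation[OF R]
    by (metis distr_cong sets_lborel)
  show "cell_rotation L R \<in> lebesgue \<rightarrow>\<^sub>M lebesgue"
    by (rule completion.measurable_completion2) (simp_all add: eq measurable_completion)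
  show "distr lebesgue lebesgue (cell_rotation L R) = lebesgue"
    using completion.completion_distr_eq[of "cell_rotation L R" lborel lborel]
    by (simp add: eq measurable_completion)
qed

text \<open>The closed box is exactly invariant, but a reflection exchanges faces that belong to the
  half-open cell with faces that do not. The difference lies in the boundary, whose preimage is
  null.\<close>

lemma AE_cell_rotation:
  assumes R: "R \<in> cube_group"
  shows "AE x in lebesgue. indicator (cell L) (cell_rotation L R x) = (indicator (cell L) x :: real)"
proof -
  let ?B = "cbox 0 (real L *\<^sub>R 1) :: (real^'d) set"
  obtain p s where p: "bij p" and s: "\<And>i. s i = 1 \<or> s i = -1"
    and R_eq: "\<And>x i. (R *v x) $ i = s i * x $ p i"
    using cube_group_signed_permutation[OF R] by metis
  have T: "cell_rotation L R x $ i = (if s i = 1 then x $ p i else real L - x $ p i)" for x i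
    by (rule cell_rotation_component[OF R_eq s])
  have B: "cell_rotation L R x \<in> ?B \<longleftrightarrow> x \<in> ?B" for x
  proof -
    have "cell_rotation L R x \<in> ?B \<longleftrightarrow> (\<forall>i. 0 \<le> x $ p i \<and> x $ p i \<le> real L)"
      by (auto simp: mem_box_cart T split: if_splits)
    also have "\<dots> \<longleftrightarrow> (\<forall>i. 0 \<le> x $ i \<and> x $ i \<le> real L)" using p by (metis bij_pointE)
    finally show ?thesis by (simp add: mem_box_cart)
  qed
  have n: "AE x in lebesgue. x \<notin> ?B - cell L"
    by (rule AE_not_in[OF negligible_cbox_minus_cell[unfolded negligible_iff_null_sets]])
  have "AE x in distr lebesgue lebesgue (cell_rotation L R). x \<notin> ?B - cell L"
    unfolding distr_lebesgue_cell_rotation[OF R] by (rule n)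
  then have "AE x in lebesgue. cell_rotation L R x \<notin> ?B - cell L"
    by (rule AE_distrD[OF measurable_cell_rotation[OF R]])
  with n show ?thesis
  proof eventually_elim
    case (elim x)
    have "cell_rotation L R x \<in> cell L \<longleftrightarrow> x \<in> cell L"
      using elim B[of x] subsetD[OF cell_between(2), of _ L] by blast
    then show ?case by (simp add: indicator_def)
  qed
qed

text \<open>The rotation preserves Lebesgue measure and, almost everywhere, the indicator of the
  cell. Periodicity of \<open>f\<close> is not assumed, because the weights that generate the
  sigma-algebra of the ensemble are arbitrary integrable functions.\<close>

lemma
  fixes f :: "real^'d \<Rightarrow> 'b::euclidean_space"
  assumes R: "R \<in> cube_group" and f: "f \<in> borel_measurable (torus L)"
  shows borel_measurable_cell_rotation: "(\<lambda>x. f (cell_rotation L R x)) \<in> borel_measurable (torus L)"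
    and integrable_cell_rotation:
      "integrable (torus L) (\<lambda>x. f (cell_rotation L R x)) \<longleftrightarrow> integrable (torus L) f"
    and integral_cell_rotation:
      "(LINT x|torus L. f (cell_rotation L R x)) = integral\<^sup>L (torus L) f"
proof -
  let ?T = "cell_rotation L R" and ?g = "\<lambda>x. indicator (cell L) x *\<^sub>R f x"
  note [measurable] = measurable_cell_rotation[OF R, of L]
  have g[measurable]: "?g \<in> borel_measurable lebesgue"
    using f by (simp add: borel_measurable_restrict_space_iff)
  have gT: "(\<lambda>x. ?g (?T x)) \<in> borel_measurable lebesgue" by measurable
  have ae: "AE x in lebesgue. ?g (?T x) = indicator (cell L) x *\<^sub>R f (?T x)"
    using AE_cell_rotation[OF R, of L] by eventually_elim simp
  have m: "(\<lambda>x. indicator (cell L) x *\<^sub>R f (?T x)) \<in> borel_measurable lebesgue"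
    by (rule borel_measurable_AE[OF gT ae])
  then show 1: "(\<lambda>x. f (?T x)) \<in> borel_measurable (torus L)"
    by (simp add: borel_measurable_restrict_space_iff)
  have "integrable lebesgue ?g \<longleftrightarrow> integrable (distr lebesgue lebesgue ?T) ?g"
    by (simp add: distr_lebesgue_cell_rotation[OF R])
  also have "\<dots> \<longleftrightarrow> integrable lebesgue (\<lambda>x. ?g (?T x))"
    by (rule integrable_distr_eq) measurable
  also have "\<dots> \<longleftrightarrow> integrable lebesgue (\<lambda>x. indicator (cell L) x *\<^sub>R f (?T x))"
    by (rule integrable_cong_AE[OF gT m ae])
  finally show "integrable (torus L) (\<lambda>x. f (?T x)) \<longleftrightarrow> integrable (torus L) f"
    by (simp add: integrable_restrict_space)
  have "integral\<^sup>L lebesgue ?g = integral\<^sup>L (distr lebesgue lebesgue ?T) ?g"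
    by (simp add: distr_lebesgue_cell_rotation[OF R])
  also have "\<dots> = (LINT x|lebesgue. ?g (?T x))"
    by (rule integral_distr) measurable
  also have "\<dots> = (LINT x|lebesgue. indicator (cell L) x *\<^sub>R f (?T x))"
    by (rule integral_cong_AE[OF gT m ae])
  finally show "(LINT x|torus L. f (?T x)) = integral\<^sup>L (torus L) f"
    by (simp add: integral_restrict_space)
qed

section \<open>Periodic functions composed with group elements\<close>

lemma sum_axis: "(\<Sum>j\<in>UNIV. axis j (h j) $ k) = (h k :: 'a::comm_monoid_add)"
proof -
  have "(\<Sum>j\<in>UNIV. axis j (h j) $ k) = (\<Sum>j\<in>UNIV. if k = j then h j else 0)"
    by (rule sum.cong) (auto simp: axis_def)
  then show ?thesis by simp
qed

lemma periodic_shift: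
  fixes f :: "real^'d \<Rightarrow> 'b"
  assumes f: "periodic L f" shows "f (x + (\<Sum>i\<in>S. axis i (real L * real (n i)))) = f x"
proof -
  have 1: "f (y + axis i (real L * real k)) = f y" for y i k
  proof (induction k)
    case (Suc k)
    have "y + axis i (real L * real (Suc k)) = (y + axis i (real L * real k)) + axis i (real L)"
      by (simp add: vec_eq_iff axis_def algebra_simps)
    then show ?case using f Suc unfolding periodic_def by metis
  qed (simp add: axis_def flip: zero_vec_def)
  have "finite S" by simp
  then show ?thesis
  proof (induction S arbitrary: x)
    case (insert i S)
    have "f (x + (\<Sum>i\<in>insert i S. axis i (real L * real (n i))))
        = f ((x + axis i (real L * real (n i))) + (\<Sum>i\<in>S. axis i (real L * real (n i))))"
      using insert.hyps by (simp add: add.assoc)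
    also have "\<dots> = f x" unfolding insert.IH by (rule 1)
    finally show ?case .
  qed simp
qed

lemma periodic_cell_rotation:
  fixes f :: "real^'d \<Rightarrow> 'b"
  assumes R: "R \<in> cube_group" and f: "periodic L f"
  shows "f (cell_rotation L R x) = f (R *v x)"
proof -
  obtain p s where p: "bij p" and s: "\<And>i. s i = 1 \<or> s i = -1"
    and R_eq: "\<And>x i. (R *v x) $ i = s i * x $ p i"
    using cube_group_signed_permutation[OF R] by metis
  have T: "cell_rotation L R x $ i = (if s i = 1 then x $ p i else real L - x $ p i)" for x i
    by (rule cell_rotation_component[OF R_eq s])
  let ?n = "\<Sum>i\<in>UNIV. axis i (real L * real (if s i = 1 then 0 else 1))"
  have "cell_rotation L R x $ i = (R *v x + ?n) $ i" for i
    using s[of i] by (auto simp: T R_eq sum_axis)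
  then have "cell_rotation L R x = R *v x + ?n" by (simp add: vec_eq_iff)
  then show ?thesis by (simp only: periodic_shift[OF f])
qed

lemma periodic_rotation:
  fixes f :: "real^'d \<Rightarrow> 'b"
  assumes R: "R \<in> cube_group" and f: "periodic L f"
  shows "periodic L (\<lambda>x. f (R *v x))"
  unfolding periodic_def
proof (intro allI)
  fix x i
  obtain p s where s: "\<And>i. s i = 1 \<or> s i = -1" and R_eq: "\<And>x i. (R *v x) $ i = s i * x $ p i"
    using cube_group_signed_permutation[OF R] by metis
  \<comment> \<open>Where \<open>s j = -1\<close>, the rotated period is a shift by -L. As
    \<open>periodic_shift\<close> handles non-negative multiples only, that shift is moved to the
    other side of the equation.\<close>
  let ?u = "\<lambda>t. \<Sum>j\<in>UNIV. axis j (real L * real (if p j = i \<and> s j = t then 1 else 0))"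
  have "(R *v (x + axis i (real L)) + ?u (- 1)) $ j = (R *v x + ?u 1) $ j" for j
    using s[of j] by (auto simp: sum_axis R_eq axis_def distrib_left)
  then have "R *v (x + axis i (real L)) + ?u (- 1) = R *v x + ?u 1" by (simp add: vec_eq_iff)
  then have "f (R *v (x + axis i (real L)) + ?u (- 1)) = f (R *v x + ?u 1)" by simp
  then show "f (R *v (x + axis i (real L))) = f (R *v x)"
    by (simp only: periodic_shift[OF f])
qed

lemma
  fixes f :: "real^'d \<Rightarrow> 'b::euclidean_space"
  assumes R: "R \<in> cube_group" and per: "periodic L f" and f: "f \<in> borel_measurable (torus L)"
  shows borel_measurable_rotation: "(\<lambda>x. f (R *v x)) \<in> borel_measurable (torus L)"
    and integrable_rotation: "integrable (torus L) (\<lambda>x. f (R *v x)) \<longleftrightarrow> integrable (torus L) f"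
    and integral_rotation: "(LINT x|torus L. f (R *v x)) = integral\<^sup>L (torus L) f"
  using borel_measurable_cell_rotation[OF R f] integrable_cell_rotation[OF R f]
    integral_cell_rotation[OF R f]
  by (simp_all add: periodic_cell_rotation[OF R per])

section \<open>Periodic test functions\<close>

definition C1_periodic :: "nat \<Rightarrow> (real^'d \<Rightarrow> real) \<Rightarrow> bool"
  where "C1_periodic L \<zeta> \<longleftrightarrow>
    periodic L \<zeta> \<and> (\<exists>\<zeta>'. (\<forall>x. GDERIV \<zeta> x :> \<zeta>' x) \<and> continuous_on UNIV \<zeta>')"

lemma GDERIV_continuous:
  assumes "\<And>x. GDERIV \<zeta> x :> \<zeta>' x" shows "continuous_on UNIV \<zeta>"
  using assms unfolding gderiv_def
  by (meson continuous_at_imp_continuous_on has_derivative_continuous)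

lemma C1_periodic_continuous:
  assumes "C1_periodic L \<zeta>" shows "continuous_on UNIV \<zeta>"
  using assms unfolding C1_periodic_def by (blast intro: GDERIV_continuous)

lemma C1_periodic_const: "C1_periodic L (\<lambda>x. c)"
  unfolding C1_periodic_def periodic_def
  by (intro conjI exI[of _ "\<lambda>x. 0"]) (auto intro: GDERIV_const)

lemma C1_periodic_mult:
  assumes f: "C1_periodic L f" and g: "C1_periodic L g" shows "C1_periodic L (\<lambda>x. f x * g x)"
proof -
  obtain f' g' where f': "\<And>x. GDERIV f x :> f' x" "continuous_on UNIV f'"
    and g': "\<And>x. GDERIV g x :> g' x" "continuous_on UNIV g'"
    using f g unfolding C1_periodic_def by blast
  have "periodic L (\<lambda>x. f x * g x)" using f g by (simp add: C1_periodic_def periodic_def)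
  moreover have "continuous_on UNIV (\<lambda>x. f x *\<^sub>R g' x + g x *\<^sub>R f' x)"
    by (intro continuous_intros C1_periodic_continuous[OF f] C1_periodic_continuous[OF g] f' g')
  ultimately show ?thesis
    unfolding C1_periodic_def
    by (intro conjI exI[of _ "\<lambda>x. f x *\<^sub>R g' x + g x *\<^sub>R f' x"] allI GDERIV_mult f' g')
qed

lemma C1_periodic_prod:
  assumes "\<And>i. i \<in> I \<Longrightarrow> C1_periodic L (f i)" shows "C1_periodic L (\<lambda>x. \<Prod>i\<in>I. f i x)"
  using assms by (induction I rule: infinite_finite_induct) (auto intro: C1_periodic_const C1_periodic_mult)

lemma C1_periodic_component:
  assumes h: "\<And>t. (h has_real_derivative h' t) (at t)" "continuous_on UNIV h'"
    and per: "\<And>t. h (t + real L) = h t"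
  shows "C1_periodic L (\<lambda>x::real^'d. h (x $ i))"
proof -
  have "GDERIV (\<lambda>x. x $ i) x :> axis i 1" for x :: "real^'d"
    unfolding gderiv_def by (simp add: inner_axis bounded_linear_imp_has_derivative bounded_linear_vec_nth)
  then have "GDERIV (\<lambda>x. h (x $ i)) x :> h' (x $ i) *\<^sub>R axis i 1" for x :: "real^'d"
    by (rule GDERIV_DERIV_compose) (rule h)
  moreover have "continuous_on UNIV (\<lambda>x::real^'d. h' (x $ i))"
    by (rule continuous_on_compose2[OF h(2)]) (auto intro!: continuous_intros)
  then have "continuous_on UNIV (\<lambda>x::real^'d. h' (x $ i) *\<^sub>R axis i (1::real))"
    by (intro continuous_on_scaleR continuous_on_const)
  moreover have "periodic L (\<lambda>x::real^'d. h (x $ i))"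
    using per by (auto simp: periodic_def axis_def)
  ultimately show ?thesis unfolding C1_periodic_def
    by (intro conjI exI[of _ "\<lambda>x. h' (x $ i) *\<^sub>R axis i 1"]) auto
qed

text \<open>Squaring the positive part makes it continuously differentiable at 0, which is all the
  regularity that test functions need. For growing \<open>n\<close> the values stay in [0, 1] and
  converge to the indicator of the positive half-line.\<close>

definition cutoff :: "nat \<Rightarrow> real \<Rightarrow> real"
  where "cutoff n u = real n * (max 0 u)\<^sup>2 / (1 + real n * (max 0 u)\<^sup>2)"

lemma cutoff_bounds: "0 \<le> cutoff n u" "cutoff n u \<le> 1"
proof -
  have "0 \<le> real n * (max 0 u)\<^sup>2" by simp
  then have "real n * (max 0 u)\<^sup>2 < 1 + real n * (max 0 u)\<^sup>2" "0 < 1 + real n * (max 0 u)\<^sup>2"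
    by linarith+
  then show "0 \<le> cutoff n u" "cutoff n u \<le> 1"
    unfolding cutoff_def by (auto simp del: zero_le_mult_iff simp: divide_le_eq_1)
qed

lemma cutoff_nonpos: "u \<le> 0 \<Longrightarrow> cutoff n u = 0"
  by (simp add: cutoff_def max_def)

lemma cutoff_tendsto: "(\<lambda>n. cutoff n u) \<longlonglongrightarrow> of_bool (0 < u)"
proof (cases "0 < u")
  case True
  have "(\<lambda>n. real n * u\<^sup>2 / (1 + real n * u\<^sup>2)) \<longlonglongrightarrow> 1" using True by real_asymp
  then show ?thesis using True by (simp add: cutoff_def max_def)
next
  case False
  then show ?thesis by (simp add: cutoff_nonpos)
qed

lemma DERIV_max_0_square: "((\<lambda>u::real. (max 0 u)\<^sup>2) has_real_derivative 2 * max 0 u) (at u)"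
proof -
  consider "u < 0" | "u = 0" | "0 < u" by linarith
  then show ?thesis
  proof cases
    case 1
    have "((\<lambda>u::real. 0) has_real_derivative 2 * max 0 u) (at u)" using 1 by (auto simp: max_def)
    then show ?thesis
      by (rule has_field_derivative_transform_within_open[where S="{..<0}"]) (use 1 in \<open>auto simp: max_def\<close>)
  next
    case 3
    have "((\<lambda>u::real. u\<^sup>2) has_real_derivative 2 * max 0 u) (at u)"
      using 3 by (auto intro!: derivative_eq_intros simp: max_def)
    then show ?thesis
      by (rule has_field_derivative_transform_within_open[where S="{0<..}"]) (use 3 in \<open>auto simp: max_def\<close>)
  next
    case 2
    have "((\<lambda>h::real. (max 0 h)\<^sup>2 / h) \<longlongrightarrow> 0) (at 0)"
    proof (rule Lim_null_comparison)
      show "\<forall>\<^sub>F h::real in at 0. norm ((max 0 h)\<^sup>2 / h) \<le> \<bar>h\<bar>"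
        by (auto simp: eventually_at_filter max_def power2_eq_square abs_mult)
      show "(abs \<longlongrightarrow> 0) (at (0::real))" by (rule tendsto_eq_intros refl | simp)+
    qed
    then show ?thesis using 2 by (simp add: DERIV_def)
  qed
qed

lemma DERIV_cutoff:
  "(cutoff n has_real_derivative real n * (2 * max 0 u) / (1 + real n * (max 0 u)\<^sup>2)\<^sup>2) (at u)"
proof -
  have pos: "1 + real n * (max 0 u)\<^sup>2 > 0" by (intro add_pos_nonneg) auto
  show ?thesis
    unfolding cutoff_def
    by (rule derivative_eq_intros DERIV_max_0_square | use pos in simp)+
      (use pos in \<open>simp add: field_simps power2_eq_square\<close>)
qed

text \<open>The cosine describes an interval in a way that is periodic with period \<open>l\<close>.
  The hypotheses on \<open>c\<close> and \<open>r\<close> keep the interval inside [0, l], so the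
  distance from \<open>t\<close> to \<open>c\<close> is at most \<open>l - r\<close> and no
  translate by a period interferes.\<close>

lemma cos_greater_iff:
  fixes t c r :: real
  assumes "0 < r" "r \<le> c" "c + r \<le> l" "0 \<le> t" "t < l"
  shows "cos (2 * pi * r / l) < cos (2 * pi * (t - c) / l) \<longleftrightarrow> \<bar>t - c\<bar> < r"
proof -
  have l: "0 < l" using assms by linarith
  let ?a = "2 * pi * r / l" and ?b = "2 * pi * \<bar>t - c\<bar> / l"
  have a: "0 \<le> ?a" "?a \<le> pi" using assms l by (auto simp: field_simps)
  have b: "0 \<le> ?b" using l by simp
  have "\<bar>2 * pi * (t - c) / l\<bar> = ?b" using l by (simp add: abs_mult)
  then have cosb: "cos (2 * pi * (t - c) / l) = cos ?b" by (metis cos_abs_real)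
  show ?thesis
  proof (cases "\<bar>t - c\<bar> < r")
    case True
    then have "?b < ?a" using l by (simp add: divide_strict_right_mono)
    then show ?thesis using True a b cosb by (simp add: cos_monotone_0_pi)
  next
    case False
    then have ab: "?a \<le> ?b" using l by (simp add: divide_right_mono)
    have "\<bar>t - c\<bar> \<le> l - r" using assms by auto
    then have "?b \<le> 2 * pi * (l - r) / l" using l by (simp add: divide_right_mono)
    then have b2: "?b \<le> 2 * pi - ?a" using l by (simp add: field_simps)
    have "cos ?b \<le> cos ?a"
    proof (cases "?b \<le> pi")
      case True
      then show ?thesis using ab a by (intro cos_monotone_0_pi_le) auto
    next
      case False
      \<comment> \<open>Beyond half a period the cosine increases again; reflecting the angle at pi
        returns to the range where it decreases.\<close>
      then have "cos (2 * pi - ?b) \<le> cos ?a" using b2 a by (intro cos_monotone_0_pi_le) auto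
      then show ?thesis by (simp add: cos_diff)
    qed
    then show ?thesis using False cosb by simp
  qed
qed

text \<open>Products of one-dimensional cutoffs of cosines are admissible test functions that approximate
  the indicator functions of boxes.\<close>

definition box_bump :: "nat \<Rightarrow> real^'d \<Rightarrow> real^'d \<Rightarrow> nat \<Rightarrow> real^'d \<Rightarrow> real"
  where "box_bump L a b n x = (\<Prod>i\<in>UNIV. cutoff n
    (cos (2 * pi * (x $ i - (a $ i + b $ i) / 2) / real L) - cos (2 * pi * ((b $ i - a $ i) / 2) / real L)))"

lemma C1_periodic_box_bump:
  assumes L: "L \<ge> 1" shows "C1_periodic L (box_bump L a b n)"
  unfolding box_bump_def
proof (rule C1_periodic_prod)
  fix i
  define s where "s t = cos (2 * pi * (t - (a $ i + b $ i) / 2) / real L)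
      - cos (2 * pi * ((b $ i - a $ i) / 2) / real L)" for t
  let ?s' = "\<lambda>t. - sin (2 * pi * (t - (a $ i + b $ i) / 2) / real L) * (2 * pi / real L)"
  let ?c' = "\<lambda>u. real n * (2 * max 0 u) / (1 + real n * (max 0 u)\<^sup>2)\<^sup>2"
  have s: "(s has_real_derivative ?s' t) (at t)" for t
    unfolding s_def by (rule derivative_eq_intros refl | use L in simp)+
  have "((\<lambda>t. cutoff n (s t)) has_real_derivative ?c' (s t) * ?s' t) (at t)" for t
    by (rule DERIV_chain2[OF DERIV_cutoff s])
  moreover have "continuous_on UNIV (\<lambda>t. ?c' (s t) * ?s' t)"
  proof -
    have "1 + real n * (max 0 u)\<^sup>2 \<noteq> 0" for u
      using add_pos_nonneg[of 1 "real n * (max 0 u)\<^sup>2"] by simp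
    then show ?thesis using L unfolding s_def by (intro continuous_intros) auto
  qed
  moreover have "cutoff n (s (t + real L)) = cutoff n (s t)" for t
  proof -
    have "2 * pi * (t + real L - (a $ i + b $ i) / 2) / real L
        = 2 * pi * (t - (a $ i + b $ i) / 2) / real L + 2 * pi"
      using L by (simp add: field_simps)
    then show ?thesis by (simp add: s_def)
  qed
  ultimately have "C1_periodic L (\<lambda>x. cutoff n (s (x $ i)))"
    by (rule C1_periodic_component)
  then show "C1_periodic L (\<lambda>x. cutoff n
    (cos (2 * pi * (x $ i - (a $ i + b $ i) / 2) / real L) - cos (2 * pi * ((b $ i - a $ i) / 2) / real L)))"
    by (simp add: s_def)
qed

lemma box_bump_bounds: "0 \<le> box_bump L a b n x" "box_bump L a b n x \<le> 1"
  unfolding box_bump_def by (auto intro!: prod_nonneg prod_le_1 simp: cutoff_bounds)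

text \<open>Each factor converges to the indicator of one coordinate interval; the cutoff vanishes
  at 0, hence the open box. The box must lie in one period for the cosine criterion to
  apply.\<close>

lemma box_bump_tendsto:
  assumes "\<And>i. 0 \<le> a $ i" "\<And>i. a $ i < b $ i" "\<And>i. b $ i \<le> real L" "x \<in> cell L"
  shows "(\<lambda>n. box_bump L a b n x) \<longlonglongrightarrow> indicator (box a b) x"
proof -
  define s where "s i = cos (2 * pi * (x $ i - (a $ i + b $ i) / 2) / real L)
    - cos (2 * pi * ((b $ i - a $ i) / 2) / real L)" for i
  have s: "0 < s i \<longleftrightarrow> a $ i < x $ i \<and> x $ i < b $ i" for i
  proof -
    have "0 < s i \<longleftrightarrow> \<bar>x $ i - (a $ i + b $ i) / 2\<bar> < (b $ i - a $ i) / 2"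
      unfolding s_def diff_gt_0_iff_gt
      using assms(1)[of i] assms(2)[of i] assms(3)[of i] assms(4)
      by (intro cos_greater_iff) (auto simp: cell_def field_simps)
    also have "\<dots> \<longleftrightarrow> a $ i < x $ i \<and> x $ i < b $ i" by (auto simp: abs_if field_simps)
    finally show ?thesis .
  qed
  have "(\<Prod>i\<in>UNIV. of_bool (0 < s i)) = (indicator (box a b) x :: real)"
    by (auto simp: indicator_def mem_box_cart s prod_zero_iff)
  moreover have "(\<lambda>n. box_bump L a b n x) \<longlonglongrightarrow> (\<Prod>i\<in>UNIV. of_bool (0 < s i))"
    unfolding box_bump_def s_def by (intro tendsto_prod cutoff_tendsto)
  ultimately show ?thesis by simp
qed

lemma continuous_measurable_torus:
  fixes f :: "real^'d \<Rightarrow> 'b::euclidean_space"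
  assumes "continuous_on UNIV f" shows "f \<in> borel_measurable (torus L)"
  by (rule measurable_restrict_space1, rule measurable_completion)
    (use borel_measurable_continuous_onI[OF assms] in simp)

lemma continuous_bounded_on_cell:
  fixes f :: "real^'d \<Rightarrow> 'b::euclidean_space"
  assumes "continuous_on UNIV f" obtains B where "\<And>x. x \<in> cell L \<Longrightarrow> norm (f x) \<le> B"
proof -
  have "compact (f ` cbox 0 (real L *\<^sub>R 1))"
    by (rule compact_continuous_image[OF continuous_on_subset[OF assms]]) auto
  then obtain B where "\<And>y. y \<in> f ` cbox 0 (real L *\<^sub>R 1) \<Longrightarrow> norm y \<le> B"
    using compact_imp_bounded bounded_iff by metis
  then show ?thesis using that subsetD[OF cell_between(2), of _ L] by blast
qed

lemma integrable_scaleR_continuous: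
  fixes f :: "real^'d \<Rightarrow> 'b::euclidean_space"
  assumes \<psi>: "integrable (torus L) \<psi>" and f: "continuous_on UNIV f"
  shows "integrable (torus L) (\<lambda>x. \<psi> x *\<^sub>R f x)"
proof -
  obtain B where B: "\<And>x. x \<in> cell L \<Longrightarrow> norm (f x) \<le> B" using continuous_bounded_on_cell[OF f] by metis
  have [measurable]: "f \<in> borel_measurable (torus L)" by (rule continuous_measurable_torus[OF f])
  show ?thesis
  proof (rule Bochner_Integration.integrable_bound)
    show "integrable (torus L) (\<lambda>x. B * \<psi> x)" using \<psi> by simp
    show "(\<lambda>x. \<psi> x *\<^sub>R f x) \<in> borel_measurable (torus L)" using \<psi> by measurable
    show "AE x in torus L. norm (\<psi> x *\<^sub>R f x) \<le> norm (B * \<psi> x)"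
    proof (rule AE_I2)
      fix x :: "real^'d" assume "x \<in> space (torus L)"
      then have "norm (f x) \<le> \<bar>B\<bar>" using B[of x] by simp
      then show "norm (\<psi> x *\<^sub>R f x) \<le> norm (B * \<psi> x)"
        by (simp add: abs_mult mult.commute[of "\<bar>B\<bar>"] mult_left_mono)
    qed
  qed
qed

lemma integrable_continuous_scaleR:
  fixes g :: "real^'d \<Rightarrow> 'b::euclidean_space"
  assumes g: "integrable (torus L) g" and f: "continuous_on UNIV f"
  shows "integrable (torus L) (\<lambda>x. f x *\<^sub>R g x)"
proof -
  obtain B where B: "\<And>x. x \<in> cell L \<Longrightarrow> norm (f x) \<le> B" using continuous_bounded_on_cell[OF f] by metis
  have [measurable]: "f \<in> borel_measurable (torus L)" by (rule continuous_measurable_torus[OF f])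
  show ?thesis
  proof (rule Bochner_Integration.integrable_bound)
    show "integrable (torus L) (\<lambda>x. B *\<^sub>R g x)" using g by simp
    show "(\<lambda>x. f x *\<^sub>R g x) \<in> borel_measurable (torus L)" using g by measurable
    show "AE x in torus L. norm (f x *\<^sub>R g x) \<le> norm (B *\<^sub>R g x)"
    proof (rule AE_I2)
      fix x :: "real^'d" assume "x \<in> space (torus L)"
      then have "\<bar>f x\<bar> \<le> \<bar>B\<bar>" using B[of x] by simp
      then show "norm (f x *\<^sub>R g x) \<le> norm (B *\<^sub>R g x)"
        by (simp add: mult_right_mono)
    qed
  qed
qed

section \<open>Weak gradients\<close>

text \<open>The bumps are test functions with values in [0, 1], so \<open>norm (g x)\<close>
  dominates and the vanishing integrals pass to the limit.\<close>

lemma integral_box_eq_0: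
  fixes g :: "real^'d \<Rightarrow> real^'d"
  assumes L: "L \<ge> 1" and g: "integrable (torus L) g"
    and orth: "\<And>\<zeta>. C1_periodic L \<zeta> \<Longrightarrow> (LINT x|torus L. \<zeta> x *\<^sub>R g x) = 0"
    and ab: "\<And>i. 0 \<le> a $ i" "\<And>i. a $ i < b $ i" "\<And>i. b $ i \<le> real L"
  shows "(LINT x|torus L. indicator (box a b) x *\<^sub>R g x) = 0"
proof -
  have "(\<lambda>n. LINT x|torus L. box_bump L a b n x *\<^sub>R g x) \<longlonglongrightarrow> (LINT x|torus L. indicator (box a b) x *\<^sub>R g x)"
  proof (rule integral_dominated_convergence)
    note [measurable] = continuous_measurable_torus[OF C1_periodic_continuous[OF C1_periodic_box_bump[OF L]]]
    have [measurable]: "box a b \<in> sets lebesgue" by simp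
    show "(\<lambda>x. indicator (box a b) x *\<^sub>R g x) \<in> borel_measurable (torus L)"
      using g by (intro borel_measurable_scaleR measurable_restrict_space1 borel_measurable_indicator
        borel_measurable_integrable) auto
    show "(\<lambda>x. box_bump L a b n x *\<^sub>R g x) \<in> borel_measurable (torus L)" for n
      using g by measurable
    show "integrable (torus L) (\<lambda>x. norm (g x))" using g by simp
    show "AE x in torus L. (\<lambda>n. box_bump L a b n x *\<^sub>R g x) \<longlonglongrightarrow> indicator (box a b) x *\<^sub>R g x"
      by (rule AE_I2) (auto intro!: tendsto_scaleR box_bump_tendsto ab)
    show "AE x in torus L. norm (box_bump L a b n x *\<^sub>R g x) \<le> norm (g x)" for n
      by (rule AE_I2) (simp add: box_bump_bounds mult_left_le_one_le)
  qed
  moreover have "(LINT x|torus L. box_bump L a b n x *\<^sub>R g x) = 0" for n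
    by (rule orth[OF C1_periodic_box_bump[OF L]])
  ultimately show ?thesis by (simp add: LIMSEQ_const_iff)
qed

lemma AE_torus_interior: "AE x in torus L. x \<in> box 0 (real L *\<^sub>R 1 :: real^'d)"
proof -
  have "AE x in lebesgue. x \<notin> cbox 0 (real L *\<^sub>R 1) - box 0 (real L *\<^sub>R 1 :: real^'d)"
    by (rule AE_not_in[OF negligible_frontier_interval[unfolded negligible_iff_null_sets]])
  then have "AE x in lebesgue. x \<in> cell L \<longrightarrow> x \<in> box 0 (real L *\<^sub>R 1 :: real^'d)"
    by eventually_elim (use subsetD[OF cell_between(2), of _ L] in blast)
  then show ?thesis by (simp add: AE_restrict_space_iff)
qed

text \<open>The fundamental lemma of the calculus of variations on the torus. Boxes form an
  intersection-stable generator of the Borel sets, so vanishing integrals spread from boxes to Borel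
  sets, then across null sets to Lebesgue sets, and an integrable field is determined almost
  everywhere by these integrals.\<close>

lemma AE_eq_0_if_orthogonal_C1_periodic:
  fixes g :: "real^'d \<Rightarrow> real^'d"
  assumes L: "L \<ge> 1" and g: "integrable (torus L) g"
    and orth: "\<And>\<zeta>. C1_periodic L \<zeta> \<Longrightarrow> (LINT x|torus L. \<zeta> x *\<^sub>R g x) = 0"
  shows "AE x in torus L. g x = 0"
proof -
  have sets_torus: "A \<inter> cell L \<in> sets (torus L)" if "A \<in> sets lebesgue" for A :: "(real^'d) set"
    using that by (auto simp: sets_restrict_space)
  have ind: "integrable (torus L) (\<lambda>x. indicator A x *\<^sub>R g x)" if "A \<in> sets lebesgue" for A :: "(real^'d) set"
  proof -
    have "integrable (torus L) (\<lambda>x. indicator (A \<inter> cell L) x *\<^sub>R g x)"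
      by (rule integrable_mult_indicator[OF sets_torus[OF that] g])
    then show ?thesis
      by (rule Bochner_Integration.integrable_cong[OF refl, THEN iffD1, rotated]) (simp add: indicator_def)
  qed
  have box: "(LINT x|torus L. indicator (box a b) x *\<^sub>R g x) = 0" for a b :: "real^'d"
  proof -
    \<comment> \<open>Clipping to the cell gives a box within one period; on the open cell the two
      indicators agree.\<close>
    define a' b' :: "real^'d" where "a' = (\<chi> i. max 0 (a $ i))" and "b' = (\<chi> i. min (real L) (b $ i))"
    have "AE x in torus L. (indicator (box a b) x :: real) = indicator (box a' b') x"
      using AE_torus_interior
      by eventually_elim (auto simp: indicator_def mem_box_cart a'_def b'_def)
    then have "(LINT x|torus L. indicator (box a b) x *\<^sub>R g x) = (LINT x|torus L. indicator (box a' b') x *\<^sub>R g x)"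
      by (intro integral_cong_AE borel_measurable_integrable ind) auto
    also have "\<dots> = 0"
    proof (cases "\<forall>i. a' $ i < b' $ i")
      case True
      then show ?thesis by (intro integral_box_eq_0[OF L g orth]) (auto simp: a'_def b'_def)
    next
      case False
      then obtain i where "\<not> a' $ i < b' $ i" by blast
      then have "box a' b' = {}" by (auto simp: mem_box_cart dest!: spec[of _ i])
      then show ?thesis by simp
    qed
    finally show ?thesis .
  qed
  \<comment> \<open>The constant test function gives the integral over the whole cell, from which
    complements are handled.\<close>
  have g0: "integral\<^sup>L (torus L) g = 0" using orth[OF C1_periodic_const[of L 1]] by simp
  have borel: "(LINT x|torus L. indicator A x *\<^sub>R g x) = 0" if "A \<in> sets borel" for A :: "(real^'d) set"
  proof -
    have gen: "sigma_sets UNIV (range (\<lambda>(a, b). box a b)) = sets (borel :: (real^'d) measure)"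
      by (simp add: borel_eq_box)
    have S: "sigma_sets UNIV (range (\<lambda>(a, b). box a b)) \<subseteq> sets (lebesgue :: (real^'d) measure)"
      unfolding gen by auto
    have "Int_stable (range (\<lambda>(a, b). box a b :: (real^'d) set))" by (auto simp: Int_stable_def box_Int_box)
    moreover have "range (\<lambda>(a, b). box a b :: (real^'d) set) \<subseteq> Pow UNIV" by simp
    moreover have "A \<in> sigma_sets UNIV (range (\<lambda>(a, b). box a b))" using that gen by simp
    ultimately show ?thesis
    proof (induction A rule: sigma_sets_induct_disjoint)
      case (basic A)
      then show ?case using box by auto
    next
      case empty
      then show ?case by simp
    next
      case (compl A)
      have "(LINT x|torus L. indicator (UNIV - A) x *\<^sub>R g x)
          = (LINT x|torus L. g x - indicator A x *\<^sub>R g x)"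
        by (rule Bochner_Integration.integral_cong) (auto simp: indicator_def)
      also have "\<dots> = integral\<^sup>L (torus L) g - (LINT x|torus L. indicator A x *\<^sub>R g x)"
        using compl S by (intro Bochner_Integration.integral_diff g ind) auto
      finally show ?case using g0 compl by simp
    next
      case (union A)
      have leb: "A i \<in> sets lebesgue" for i using union S by auto
      have UN: "(\<Union>i. A i \<inter> cell L) = (\<Union>i. A i) \<inter> cell L" by blast
      have eq: "(LINT x:B \<inter> cell L|torus L. g x) = (LINT x|torus L. indicator B x *\<^sub>R g x)" for B
        unfolding set_lebesgue_integral_def
        by (rule Bochner_Integration.integral_cong) (auto simp: indicator_def)
      have "(LINT x:(\<Union>i. A i \<inter> cell L)|torus L. g x) = (\<Sum>i. (LINT x:A i \<inter> cell L|torus L. g x))"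
      proof (rule lebesgue_integral_countable_add)
        show "A i \<inter> cell L \<in> sets (torus L)" for i by (rule sets_torus[OF leb])
        show "A i \<inter> cell L \<inter> (A j \<inter> cell L) = {}" if "i \<noteq> j" for i j
          using union.hyps(1) that by (auto simp: disjoint_family_on_def)
        show "set_integrable (torus L) (\<Union>i. A i \<inter> cell L) g"
          unfolding set_integrable_def UN using leb
          by (intro integrable_mult_indicator g sets_torus) auto
      qed
      then show ?case using union.IH unfolding UN eq by simp
    qed
  qed
  interpret finite_measure "torus L :: (real^'d) measure" by (rule finite_measure_torus)
  show ?thesis
  proof (rule density_unique_banach[OF g integrable_zero])
    fix A :: "(real^'d) set" assume "A \<in> sets (torus L)"
    then have "A \<in> sets lebesgue" by (auto simp: sets_restrict_space_iff)
    then obtain S N N' where A: "A = S \<union> N" "N \<subseteq> N'" "N' \<in> null_sets lborel" "S \<in> sets lborel"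
      by (rule sets_completionE)
    \<comment> \<open>A Lebesgue set is a Borel set \<open>S\<close> enlarged by a part of a Borel
      null set \<open>N'\<close>.\<close>
    have "AE x in lebesgue. x \<notin> N'" using A(3) by (intro AE_not_in null_sets_completionI)
    then have "AE x in torus L. x \<notin> N'" by (auto simp: AE_restrict_space_iff elim: eventually_mono)
    then have "AE x in torus L. indicator A x *\<^sub>R g x = indicator S x *\<^sub>R g x"
      by eventually_elim (use A in \<open>auto simp: indicator_def\<close>)
    then have "(LINT x|torus L. indicator A x *\<^sub>R g x) = (LINT x|torus L. indicator S x *\<^sub>R g x)"
      using A \<open>A \<in> sets lebesgue\<close>
      by (intro integral_cong_AE borel_measurable_integrable ind) auto
    then show "set_lebesgue_integral (torus L) A g = set_lebesgue_integral (torus L) A (\<lambda>x. 0)"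
      using borel A by (simp add: set_lebesgue_integral_def)
  qed
qed

lemma has_weak_gradient_torus:
  "has_weak_gradient L \<psi> g \<longleftrightarrow>
    periodic L \<psi> \<and> integrable (torus L) \<psi> \<and> periodic L g \<and> integrable (torus L) g \<and>
    (\<forall>\<zeta> \<zeta>'. periodic L \<zeta> \<longrightarrow> (\<forall>x. GDERIV \<zeta> x :> \<zeta>' x) \<longrightarrow> continuous_on UNIV \<zeta>' \<longrightarrow>
      (LINT x|torus L. \<psi> x *\<^sub>R \<zeta>' x) = - (LINT x|torus L. \<zeta> x *\<^sub>R g x))"
  unfolding has_weak_gradient_def by (simp only: set_integrable_cell set_lebesgue_integral_cell)

lemma has_weak_gradientD:
  assumes "has_weak_gradient L \<psi> g" "periodic L \<zeta>" "\<And>x. GDERIV \<zeta> x :> \<zeta>' x" "continuous_on UNIV \<zeta>'"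
  shows "(LINT x|torus L. \<psi> x *\<^sub>R \<zeta>' x) = - (LINT x|torus L. \<zeta> x *\<^sub>R g x)"
  using assms by (simp add: has_weak_gradient_torus)

text \<open>The difference of two weak gradients is orthogonal to all test functions. The potentials
  need to agree only almost everywhere, in keeping with the notion of finite dimension for
  \<open>X\<close>.\<close>

lemma has_weak_gradient_unique:
  fixes g h :: "real^'d \<Rightarrow> real^'d"
  assumes L: "L \<ge> 1" and g: "has_weak_gradient L \<psi> g" and h: "has_weak_gradient L \<phi> h"
    and eq: "AE x in torus L. \<psi> x = \<phi> x"
  shows "AE x in torus L. g x = h x"
proof -
  have ig: "integrable (torus L) g" and ih: "integrable (torus L) h"
    and i\<psi>: "integrable (torus L) \<psi>" and i\<phi>: "integrable (torus L) \<phi>"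
    using g h unfolding has_weak_gradient_torus by auto
  have "AE x in torus L. g x - h x = 0"
  proof (rule AE_eq_0_if_orthogonal_C1_periodic[OF L Bochner_Integration.integrable_diff[OF ig ih]])
    fix \<zeta> :: "real^'d \<Rightarrow> real" assume \<zeta>: "C1_periodic L \<zeta>"
    then obtain \<zeta>' where \<zeta>': "periodic L \<zeta>" "\<forall>x. GDERIV \<zeta> x :> \<zeta>' x" "continuous_on UNIV \<zeta>'"
      unfolding C1_periodic_def by blast
    have "(LINT x|torus L. \<zeta> x *\<^sub>R g x) = - (LINT x|torus L. \<psi> x *\<^sub>R \<zeta>' x)"
      using g \<zeta>' unfolding has_weak_gradient_torus by simp
    also have "(LINT x|torus L. \<psi> x *\<^sub>R \<zeta>' x) = (LINT x|torus L. \<phi> x *\<^sub>R \<zeta>' x)"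
      using eq by (intro integral_cong_AE borel_measurable_integrable
        integrable_scaleR_continuous[OF i\<psi> \<zeta>'(3)] integrable_scaleR_continuous[OF i\<phi> \<zeta>'(3)])
        (auto elim: eventually_mono)
    also have "- \<dots> = (LINT x|torus L. \<zeta> x *\<^sub>R h x)"
      using h \<zeta>' unfolding has_weak_gradient_torus by simp
    finally show "(LINT x|torus L. \<zeta> x *\<^sub>R (g x - h x)) = 0"
      using C1_periodic_continuous[OF \<zeta>] ig ih
      by (simp add: scaleR_diff_right integrable_continuous_scaleR)
  qed
  then show ?thesis by simp
qed

lemma has_weak_gradient_zero: "has_weak_gradient L (\<lambda>x. 0) (\<lambda>x. 0)"
  by (simp add: has_weak_gradient_torus periodic_def)

lemma has_weak_gradient_scale_add:
  fixes g h :: "real^'d \<Rightarrow> real^'d"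
  assumes \<psi>: "has_weak_gradient L \<psi> g" and \<phi>: "has_weak_gradient L \<phi> h"
  shows "has_weak_gradient L (\<lambda>x. c * \<psi> x + \<phi> x) (\<lambda>x. c *\<^sub>R g x + h x)"
  unfolding has_weak_gradient_torus
proof (intro conjI allI impI)
  have i: "integrable (torus L) g" "integrable (torus L) h" "integrable (torus L) \<psi>" "integrable (torus L) \<phi>"
    using \<psi> \<phi> unfolding has_weak_gradient_torus by auto
  then show "integrable (torus L) (\<lambda>x. c * \<psi> x + \<phi> x)" "integrable (torus L) (\<lambda>x. c *\<^sub>R g x + h x)" by auto
  show "periodic L (\<lambda>x. c * \<psi> x + \<phi> x)" "periodic L (\<lambda>x. c *\<^sub>R g x + h x)"
    using \<psi> \<phi> by (auto simp: has_weak_gradient_torus periodic_def)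
  fix \<zeta> :: "real^'d \<Rightarrow> real" and \<zeta>' assume \<zeta>: "periodic L \<zeta>" "\<forall>x. GDERIV \<zeta> x :> \<zeta>' x" "continuous_on UNIV \<zeta>'"
  have c: "continuous_on UNIV \<zeta>" using \<zeta>(2) by (blast intro: GDERIV_continuous)
  have "(LINT x|torus L. (c * \<psi> x + \<phi> x) *\<^sub>R \<zeta>' x)
      = (LINT x|torus L. c *\<^sub>R (\<psi> x *\<^sub>R \<zeta>' x) + \<phi> x *\<^sub>R \<zeta>' x)"
    by (simp add: scaleR_add_left)
  also have "\<dots> = c *\<^sub>R (LINT x|torus L. \<psi> x *\<^sub>R \<zeta>' x) + (LINT x|torus L. \<phi> x *\<^sub>R \<zeta>' x)"
    using i \<zeta> by (simp add: integrable_scaleR_continuous del: scaleR_scaleR)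
  also have "\<dots> = - (c *\<^sub>R (LINT x|torus L. \<zeta> x *\<^sub>R g x) + (LINT x|torus L. \<zeta> x *\<^sub>R h x))"
    using \<psi> \<phi> \<zeta> unfolding has_weak_gradient_torus by simp
  also have "\<dots> = - (LINT x|torus L. c *\<^sub>R (\<zeta> x *\<^sub>R g x) + \<zeta> x *\<^sub>R h x)"
    using i c by (simp add: integrable_continuous_scaleR del: scaleR_scaleR)
  finally show "(LINT x|torus L. (c * \<psi> x + \<phi> x) *\<^sub>R \<zeta>' x) = - (LINT x|torus L. \<zeta> x *\<^sub>R (c *\<^sub>R g x + h x))"
    by (simp add: scaleR_add_right mult.commute)
qed

lemma has_weak_gradient_sum:
  assumes "finite I" "\<And>i. i \<in> I \<Longrightarrow> has_weak_gradient L (\<psi> i) (g i)"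
  shows "has_weak_gradient L (\<lambda>x. \<Sum>i\<in>I. c i * \<psi> i x) (\<lambda>x. \<Sum>i\<in>I. c i *\<^sub>R g i x)"
  using assms
  by (induction I rule: finite_induct) (auto intro: has_weak_gradient_zero has_weak_gradient_scale_add)

text \<open>The chain rule is shifted to the test function:
  \<open>\<zeta> (transpose R *v y)\<close> is admissible with gradient
  \<open>R *v \<zeta>' (transpose R *v y)\<close>, and a change of variables on both sides of the
  weak identity does the rest.\<close>

lemma has_weak_gradient_rotation:
  fixes g :: "real^'d \<Rightarrow> real^'d"
  assumes R: "R \<in> cube_group" and \<psi>: "has_weak_gradient L \<psi> g"
  shows "has_weak_gradient L (\<lambda>x. \<psi> (R *v x)) (\<lambda>x. transpose R *v g (R *v x))"
  unfolding has_weak_gradient_torus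
proof (intro conjI allI impI)
  note Rt = cube_group_transpose[OF R]
  have per: "periodic L \<psi>" "periodic L g" and i: "integrable (torus L) \<psi>" "integrable (torus L) g"
    using \<psi> unfolding has_weak_gradient_torus by auto
  have lin: "bounded_linear ((*v) (transpose R))" by (rule matrix_vector_mul_bounded_linear)
  show "periodic L (\<lambda>x. \<psi> (R *v x))" by (rule periodic_rotation[OF R per(1)])
  show "periodic L (\<lambda>x. transpose R *v g (R *v x))"
    using periodic_rotation[OF R per(2)] by (simp add: periodic_def)
  show "integrable (torus L) (\<lambda>x. \<psi> (R *v x))"
    using integrable_rotation[OF R per(1)] i by simp
  have "integrable (torus L) (\<lambda>x. g (R *v x))"
    using integrable_rotation[OF R per(2)] i by simp
  then show "integrable (torus L) (\<lambda>x. transpose R *v g (R *v x))"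
    by (rule integrable_bounded_linear[OF lin])
  fix \<zeta> :: "real^'d \<Rightarrow> real" and \<zeta>' assume \<zeta>: "periodic L \<zeta>" "\<forall>x. GDERIV \<zeta> x :> \<zeta>' x" "continuous_on UNIV \<zeta>'"
  let ?\<zeta> = "\<lambda>y. \<zeta> (transpose R *v y)" and ?\<zeta>' = "\<lambda>y. R *v \<zeta>' (transpose R *v y)"
  have cR: "continuous_on UNIV (\<lambda>y. transpose R *v y)"
    by (intro bounded_linear.continuous_on[OF lin] continuous_intros)
  have per': "periodic L ?\<zeta>" by (rule periodic_rotation[OF Rt \<zeta>(1)])
  have der': "GDERIV ?\<zeta> y :> ?\<zeta>' y" for y
  proof -
    have "((\<lambda>y. transpose R *v y) has_derivative (\<lambda>h. transpose R *v h)) (at y)"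
      by (rule bounded_linear_imp_has_derivative[OF lin])
    moreover have "(\<zeta> has_derivative (\<lambda>h. h \<bullet> \<zeta>' (transpose R *v y))) (at (transpose R *v y))"
      using \<zeta>(2) by (simp add: gderiv_def)
    ultimately have "(?\<zeta> has_derivative (\<lambda>h. (transpose R *v h) \<bullet> \<zeta>' (transpose R *v y))) (at y)"
      by (rule has_derivative_compose)
    then show ?thesis by (simp add: gderiv_def inner_transpose_matrix)
  qed
  have cont': "continuous_on UNIV ?\<zeta>'"
    by (intro bounded_linear.continuous_on[OF matrix_vector_mul_bounded_linear]
        continuous_on_compose2[OF \<zeta>(3) cR]) auto
  have c\<zeta>: "continuous_on UNIV \<zeta>" using \<zeta>(2) by (blast intro: GDERIV_continuous)
  have c': "continuous_on UNIV ?\<zeta>" by (rule continuous_on_compose2[OF c\<zeta> cR]) auto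
  have \<zeta>'R: "\<zeta>' (transpose R *v y) = transpose R *v ?\<zeta>' y" for y using R by simp
  \<comment> \<open>The change of variables asks for a periodic integrand, while a test function is
    only assumed periodic itself; its gradient inherits the property because derivatives are
    unique.\<close>
  have p1: "periodic L (\<lambda>y. \<psi> y *\<^sub>R ?\<zeta>' y)"
  proof -
    have "?\<zeta>' (y + axis i (real L)) = ?\<zeta>' y" for y i
    proof -
      have shift: "GDERIV ?\<zeta> y :> ?\<zeta>' (y + axis i (real L))"
      proof -
        have "((\<lambda>y. ?\<zeta> (y + axis i (real L))) has_derivative (\<lambda>h. h \<bullet> ?\<zeta>' (y + axis i (real L)))) (at y)"
          using der'[of "y + axis i (real L)"] unfolding gderiv_def
          by (rule has_derivative_compose[rotated]) (auto intro!: derivative_eq_intros)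
        moreover have "(\<lambda>y. ?\<zeta> (y + axis i (real L))) = ?\<zeta>" using per' by (simp add: periodic_def)
        ultimately show ?thesis by (simp add: gderiv_def)
      qed
      have "(\<lambda>h. h \<bullet> ?\<zeta>' (y + axis i (real L))) = (\<lambda>h. h \<bullet> ?\<zeta>' y)"
        using shift der'[of y] unfolding gderiv_def by (rule has_derivative_unique)
      then have "h \<bullet> ?\<zeta>' (y + axis i (real L)) = h \<bullet> ?\<zeta>' y" for h by (rule fun_cong)
      then show ?thesis by (rule iffD1[OF vector_eq_ldot, OF allI])
    qed
    then show ?thesis using per by (simp add: periodic_def)
  qed
  have "(LINT x|torus L. \<psi> (R *v x) *\<^sub>R \<zeta>' x) = (LINT x|torus L. transpose R *v (\<psi> (R *v x) *\<^sub>R ?\<zeta>' (R *v x)))"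
    using R by (simp add: matrix_vector_mult_scaleR)
  also have "\<dots> = transpose R *v (LINT x|torus L. \<psi> (R *v x) *\<^sub>R ?\<zeta>' (R *v x))"
    using integrable_rotation[OF R p1] integrable_scaleR_continuous[OF i(1) cont']
    by (intro integral_bounded_linear[OF lin]) simp
  also have "(LINT x|torus L. \<psi> (R *v x) *\<^sub>R ?\<zeta>' (R *v x)) = (LINT y|torus L. \<psi> y *\<^sub>R ?\<zeta>' y)"
    using integral_rotation[OF R p1] integrable_scaleR_continuous[OF i(1) cont'] by simp
  also have "\<dots> = - (LINT y|torus L. ?\<zeta> y *\<^sub>R g y)"
    by (rule has_weak_gradientD[OF \<psi> per' der' cont'])
  also have "(LINT y|torus L. ?\<zeta> y *\<^sub>R g y) = (LINT x|torus L. \<zeta> x *\<^sub>R g (R *v x))"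
  proof -
    have p2: "periodic L (\<lambda>y. ?\<zeta> y *\<^sub>R g y)" using per per' by (simp add: periodic_def)
    show ?thesis
      using integral_rotation[OF R p2] integrable_continuous_scaleR[OF i(2) c'] R by simp
  qed
  also have "transpose R *v - (LINT x|torus L. \<zeta> x *\<^sub>R g (R *v x))
      = - (LINT x|torus L. transpose R *v (\<zeta> x *\<^sub>R g (R *v x)))"
    using integral_bounded_linear[OF lin, of "torus L" "\<lambda>x. \<zeta> x *\<^sub>R g (R *v x)"]
      integrable_continuous_scaleR[OF \<open>integrable (torus L) (\<lambda>x. g (R *v x))\<close> c\<zeta>]
    by (simp add: linear_neg[OF matrix_vector_mul_linear])
  finally show "(LINT x|torus L. \<psi> (R *v x) *\<^sub>R \<zeta>' x)
      = - (LINT x|torus L. \<zeta> x *\<^sub>R (transpose R *v g (R *v x)))"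
    by (simp add: matrix_vector_mult_scaleR)
qed

section \<open>The energy form\<close>

definition L2_field :: "nat \<Rightarrow> (real^'d \<Rightarrow> real^'d) \<Rightarrow> bool"
  where "L2_field L u \<longleftrightarrow>
    u \<in> borel_measurable (torus L) \<and> integrable (torus L) (\<lambda>x. (norm (u x))\<^sup>2)"

lemma borel_measurable_vec_component:
  assumes "u \<in> borel_measurable M" shows "(\<lambda>x. u x $ i :: 'b::euclidean_space) \<in> borel_measurable M"
  by (rule measurable_compose[OF assms]) (rule borel_measurable_continuous_onI, intro continuous_intros)

lemma L2_field_const: "L2_field L (\<lambda>x. c)"
proof -
  interpret finite_measure "torus L :: (real^'d) measure" by (rule finite_measure_torus)
  show ?thesis by (simp add: L2_field_def)
qed

lemma L2_field_scale:
  assumes "L2_field L u" shows "L2_field L (\<lambda>x. c *\<^sub>R u x)"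
  using assms by (auto simp: L2_field_def power_mult_distrib)

lemma L2_field_add:
  fixes u v :: "real^'d \<Rightarrow> real^'d"
  assumes u: "L2_field L u" and v: "L2_field L v" shows "L2_field L (\<lambda>x. u x + v x)"
  unfolding L2_field_def
proof
  show m: "(\<lambda>x. u x + v x) \<in> borel_measurable (torus L)"
    using u v by (intro borel_measurable_add) (auto simp: L2_field_def)
  show "integrable (torus L) (\<lambda>x. (norm (u x + v x))\<^sup>2)"
  proof (rule Bochner_Integration.integrable_bound)
    show "integrable (torus L) (\<lambda>x. 2 * (norm (u x))\<^sup>2 + 2 * (norm (v x))\<^sup>2)"
      using u v by (simp add: L2_field_def)
    show "(\<lambda>x. (norm (u x + v x))\<^sup>2) \<in> borel_measurable (torus L)" using m by measurable
    have "(norm (a + b))\<^sup>2 \<le> 2 * (norm a)\<^sup>2 + 2 * (norm b)\<^sup>2" for a b :: "real^'d"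
    proof -
      have "(norm (a + b))\<^sup>2 \<le> (norm a + norm b)\<^sup>2" by (intro power_mono norm_triangle_ineq) simp
      also have "\<dots> \<le> 2 * (norm a)\<^sup>2 + 2 * (norm b)\<^sup>2" using sum_squares_bound[of "norm a" "norm b"] by (simp add: power2_sum)
      finally show ?thesis .
    qed
    then show "AE x in torus L. norm ((norm (u x + v x))\<^sup>2) \<le> norm (2 * (norm (u x))\<^sup>2 + 2 * (norm (v x))\<^sup>2)"
      by (intro AE_I2) simp
  qed
qed

lemma L2_field_sum:
  assumes "\<And>i. i \<in> I \<Longrightarrow> L2_field L (u i)" shows "L2_field L (\<lambda>x. \<Sum>i\<in>I. u i x)"
  using assms by (induction I rule: infinite_finite_induct) (auto intro: L2_field_const L2_field_add)

text \<open>These products are the weights against which the entries of a coefficient field are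
  integrated, both for the existence of energies and for their measurability as functions of the
  field.\<close>

lemma integrable_L2_field_mult:
  fixes u v :: "real^'d \<Rightarrow> real^'d"
  assumes u: "L2_field L u" and v: "L2_field L v"
  shows "integrable (torus L) (\<lambda>x. u x $ i * v x $ j)"
proof (rule Bochner_Integration.integrable_bound)
  show "integrable (torus L) (\<lambda>x. (norm (u x))\<^sup>2 + (norm (v x))\<^sup>2)"
    using u v by (simp add: L2_field_def)
  show "(\<lambda>x. u x $ i * v x $ j) \<in> borel_measurable (torus L)"
    using u v by (intro borel_measurable_times borel_measurable_vec_component) (auto simp: L2_field_def)
  have "\<bar>a $ i * b $ j\<bar> \<le> (norm a)\<^sup>2 + (norm b)\<^sup>2" for a b :: "real^'d"
  proof -
    have "\<bar>a $ i * b $ j\<bar> \<le> norm a * norm b"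
      unfolding abs_mult by (intro mult_mono component_le_norm_cart) auto
    also have "\<dots> \<le> (norm a)\<^sup>2 + (norm b)\<^sup>2"
    proof -
      have "0 \<le> norm a * norm b" by simp
      then show ?thesis using sum_squares_bound[of "norm a" "norm b"] by linarith
    qed
    finally show ?thesis .
  qed
  then show "AE x in torus L. norm (u x $ i * v x $ j) \<le> norm ((norm (u x))\<^sup>2 + (norm (v x))\<^sup>2)"
    by (intro AE_I2) simp
qed

definition energy_form :: "nat \<Rightarrow> (real^'d \<Rightarrow> real^'d^'d) \<Rightarrow> (real^'d \<Rightarrow> real^'d) \<Rightarrow> (real^'d \<Rightarrow> real^'d) \<Rightarrow> real"
  where "energy_form L A u v = (LINT x|torus L. u x \<bullet> (A x *v v x))"

lemma inner_matrix_vector_expand: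
  fixes A :: "real^'d^'d"
  shows "u \<bullet> (A *v v) = (\<Sum>i\<in>UNIV. \<Sum>j\<in>UNIV. u $ i * v $ j * A $ i $ j)"
  by (simp add: inner_vec_def matrix_vector_mult_def sum_distrib_left mult_ac)

section \<open>Positive semidefinite energies of an elliptic field\<close>

locale elliptic_field =
  fixes L :: nat and \<alpha>\<^sub>0 \<beta>\<^sub>0 :: real and A :: "real^'d \<Rightarrow> real^'d^'d"
  assumes coeff: "A \<in> coeff_fields L \<alpha>\<^sub>0 \<beta>\<^sub>0" and ellipticity: "0 < \<alpha>\<^sub>0"
begin

lemma symmetric: "transpose (A x) = A x"
  using coeff by (simp add: coeff_fields_def)

lemma bounds: "\<alpha>\<^sub>0 * (\<xi> \<bullet> \<xi>) \<le> \<xi> \<bullet> (A x *v \<xi>)" "\<xi> \<bullet> (A x *v \<xi>) \<le> \<beta>\<^sub>0 * (\<xi> \<bullet> \<xi>)"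
  using coeff by (auto simp: coeff_fields_def)

lemma positive: "0 \<le> \<xi> \<bullet> (A x *v \<xi>)"
  by (rule order_trans[OF _ bounds(1)]) (use ellipticity in simp)

text \<open>Positivity of the quadratic form at \<open>axis i 1 + axis j 1\<close> and
  \<open>axis i 1 - axis j 1\<close> bounds twice the modulus of the entry by the sum of two
  diagonal entries, each at most \<open>\<beta>\<^sub>0\<close>.\<close>

lemma entry_bound: "\<bar>A x $ i $ j\<bar> \<le> \<beta>\<^sub>0"
proof -
  have e: "axis k 1 \<bullet> (A x *v axis l 1) = A x $ k $ l" for k l
    by (simp add: inner_axis' matrix_vector_mul_component cart_eq_inner_axis[symmetric] inner_axis)
  have sym: "A x $ j $ i = A x $ i $ j" 
    using arg_cong[OF symmetric[of x], of "\<lambda>B. B $ i $ j"] by (simp add: transpose_def)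
  let ?q = "\<lambda>\<xi>. \<xi> \<bullet> (A x *v \<xi>)"
  have "?q (axis i 1 + axis j 1) = A x $ i $ i + A x $ j $ j + 2 * A x $ i $ j"
    "?q (axis i 1 - axis j 1) = A x $ i $ i + A x $ j $ j - 2 * A x $ i $ j"
    by (simp_all add: inner_add_left inner_diff_left inner_add_right inner_diff_right
      matrix_vector_right_distrib matrix_vector_mult_diff_distrib e sym)
  moreover have "0 \<le> ?q (axis i 1 + axis j 1)" "0 \<le> ?q (axis i 1 - axis j 1)" by (rule positive)+
  moreover have "A x $ i $ i \<le> \<beta>\<^sub>0" "A x $ j $ j \<le> \<beta>\<^sub>0"
    using bounds(2)[of "axis i 1" x] bounds(2)[of "axis j 1" x] by (simp_all add: e inner_axis_axis)
  ultimately show ?thesis by linarith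
qed

lemma measurable_entry: "(\<lambda>x. A x $ i $ j) \<in> borel_measurable (torus L)"
  using coeff by (intro borel_measurable_vec_component measurable_restrict_space1) (auto simp: coeff_fields_def)

lemma integrable_weight_entry:
  assumes w: "integrable (torus L) w" shows "integrable (torus L) (\<lambda>x. w x * A x $ i $ j)"
proof (rule Bochner_Integration.integrable_bound)
  show "integrable (torus L) (\<lambda>x. \<beta>\<^sub>0 * w x)" using w by simp
  show "(\<lambda>x. w x * A x $ i $ j) \<in> borel_measurable (torus L)"
    using w by (intro borel_measurable_times measurable_entry) auto
  show "AE x in torus L. norm (w x * A x $ i $ j) \<le> norm (\<beta>\<^sub>0 * w x)"
  proof (rule AE_I2)
    fix x
    have "\<bar>A x $ i $ j\<bar> \<le> \<bar>\<beta>\<^sub>0\<bar>" using entry_bound[of x i j] by linarith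
    then show "norm (w x * A x $ i $ j) \<le> norm (\<beta>\<^sub>0 * w x)"
      by (simp add: abs_mult mult.commute[of "\<bar>\<beta>\<^sub>0\<bar>"] mult_left_mono)
  qed
qed

lemma integrable_energy:
  assumes "L2_field L u" "L2_field L v"
  shows "integrable (torus L) (\<lambda>x. u x \<bullet> (A x *v v x))"
  unfolding inner_matrix_vector_expand
  by (intro Bochner_Integration.integrable_sum integrable_weight_entry integrable_L2_field_mult assms)

lemma energy_form_expand:
  assumes "L2_field L u" "L2_field L v"
  shows "energy_form L A u v = (\<Sum>i\<in>UNIV. \<Sum>j\<in>UNIV. LINT x|torus L. u x $ i * v x $ j * A x $ i $ j)"
  unfolding energy_form_def inner_matrix_vector_expand
  by (subst Bochner_Integration.integral_sum Bochner_Integration.integral_sum,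
      intro Bochner_Integration.integrable_sum integrable_weight_entry integrable_L2_field_mult assms)+ simp

lemma energy_form_sym: "energy_form L A u v = energy_form L A v u"
proof -
  have "u x \<bullet> (A x *v v x) = v x \<bullet> (A x *v u x)" for x
    using inner_transpose_matrix[of "A x" "u x" "v x"] by (simp add: symmetric inner_commute)
  then show ?thesis by (simp add: energy_form_def)
qed

lemma energy_form_nonneg: "0 \<le> energy_form L A u u"
  unfolding energy_form_def by (intro integral_nonneg_AE AE_I2 positive)

lemma energy_form_add_right:
  assumes "L2_field L u" "L2_field L v" "L2_field L w"
  shows "energy_form L A u (\<lambda>x. v x + w x) = energy_form L A u v + energy_form L A u w"
  unfolding energy_form_def using assms
  by (simp add: matrix_vector_right_distrib inner_add_right integrable_energy)

lemma energy_form_scale_right: "energy_form L A u (\<lambda>x. c *\<^sub>R v x) = c * energy_form L A u v"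
  unfolding energy_form_def by (simp add: matrix_vector_mult_scaleR)

lemma energy_form_zero_right: "energy_form L A u (\<lambda>x. 0) = 0"
  unfolding energy_form_def by simp

lemma energy_form_sum_right:
  assumes "L2_field L u" "finite I" "\<And>i. i \<in> I \<Longrightarrow> L2_field L (v i)"
  shows "energy_form L A u (\<lambda>x. \<Sum>i\<in>I. c i *\<^sub>R v i x) = (\<Sum>i\<in>I. c i * energy_form L A u (v i))"
  using assms(2,3)
  by (induction I rule: finite_induct)
    (simp_all add: energy_form_zero_right energy_form_add_right energy_form_scale_right assms(1)
      L2_field_scale L2_field_sum)

lemma energy_form_add_left:
  assumes "L2_field L u" "L2_field L v" "L2_field L w"
  shows "energy_form L A (\<lambda>x. v x + w x) u = energy_form L A v u + energy_form L A w u"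
  using energy_form_add_right[OF assms] by (simp add: energy_form_sym[of _ u])

lemma energy_form_sum_left:
  assumes "L2_field L u" "finite I" "\<And>i. i \<in> I \<Longrightarrow> L2_field L (v i)"
  shows "energy_form L A (\<lambda>x. \<Sum>i\<in>I. c i *\<^sub>R v i x) u = (\<Sum>i\<in>I. c i * energy_form L A (v i) u)"
  using energy_form_sum_right[OF assms, where c = c] by (simp add: energy_form_sym[of _ u])

lemma energy_form_cong_AE:
  assumes "L2_field L u" "L2_field L u'" "L2_field L v" "L2_field L v'"
    and "AE x in torus L. u x = u' x" "AE x in torus L. v x = v' x"
  shows "energy_form L A u v = energy_form L A u' v'"
  unfolding energy_form_def
proof (intro integral_cong_AE borel_measurable_integrable integrable_energy assms)
  show "AE x in torus L. u x \<bullet> (A x *v v x) = u' x \<bullet> (A x *v v' x)"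
    using assms(5,6) by eventually_elim simp
qed

text \<open>The energy of \<open>v + t u\<close> is affine in \<open>t\<close> and non-negative, so
  its slope vanishes. This stands in for definiteness when gradients are linearly dependent.\<close>

lemma energy_form_eq_0:
  assumes u: "L2_field L u" and v: "L2_field L v" and 0: "energy_form L A u u = 0"
  shows "energy_form L A u v = 0"
proof (rule ccontr)
  assume neq: "energy_form L A u v \<noteq> 0"
  let ?a = "energy_form L A u v" and ?b = "energy_form L A v v"
  have ineq: "0 \<le> ?b + 2 * t * ?a" for t
  proof -
    have tu: "L2_field L (\<lambda>x. t *\<^sub>R u x)" by (rule L2_field_scale[OF u])
    have "0 \<le> energy_form L A (\<lambda>x. v x + t *\<^sub>R u x) (\<lambda>x. v x + t *\<^sub>R u x)" by (rule energy_form_nonneg)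
    also have "\<dots> = ?b + 2 * t * ?a"
      using u v tu by (simp add: energy_form_add_left energy_form_add_right L2_field_add
        energy_form_scale_right energy_form_sym[of "\<lambda>x. t *\<^sub>R u x"] energy_form_sym[of v u] 0)
    finally show ?thesis .
  qed
  \<comment> \<open>With this \<open>t\<close> the affine function would take the value -1.\<close>
  have "2 * (- (?b + 1) / (2 * ?a)) * ?a = - (?b + 1)" using neq by simp
  then show False using ineq[of "- (?b + 1) / (2 * ?a)"] by linarith
qed

text \<open>Gram-Schmidt, one field at a time: \<open>p\<close> is the new field made orthogonal to
  the earlier ones, \<open>r\<close> the residual of \<open>v\<close>, and \<open>r\<close> is
  corrected along \<open>p\<close>. The family may be linearly dependent.\<close>

lemma energy_projection:
  assumes "finite I" "\<And>i. i \<in> I \<Longrightarrow> L2_field L (u i)" "L2_field L v"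
  shows "\<exists>c. \<forall>j\<in>I. energy_form L A (u j) (\<lambda>x. v x + (\<Sum>i\<in>I. c i *\<^sub>R u i x)) = 0"
  using assms
proof (induction I arbitrary: v rule: finite_induct)
  case (insert k I)
  have uI: "L2_field L (u i)" if "i \<in> I" for i using insert.prems that by blast
  have uk: "L2_field L (u k)" using insert.prems by blast
  obtain a where a: "\<And>j. j \<in> I \<Longrightarrow> energy_form L A (u j) (\<lambda>x. u k x + (\<Sum>i\<in>I. a i *\<^sub>R u i x)) = 0"
    using insert.IH[OF uI uk] by blast
  obtain b where b: "\<And>j. j \<in> I \<Longrightarrow> energy_form L A (u j) (\<lambda>x. v x + (\<Sum>i\<in>I. b i *\<^sub>R u i x)) = 0"
    using insert.IH[OF uI insert.prems(2)] by blast
  define p where "p = (\<lambda>x. u k x + (\<Sum>i\<in>I. a i *\<^sub>R u i x))"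
  define r where "r = (\<lambda>x. v x + (\<Sum>i\<in>I. b i *\<^sub>R u i x))"
  have p: "L2_field L p" and r: "L2_field L r"
    unfolding p_def r_def using uI uk insert.prems(2) by (auto intro!: L2_field_add L2_field_sum L2_field_scale)
  \<comment> \<open>If \<open>p\<close> has zero energy, the quotient is 0 by convention, and
    \<open>energy_form_eq_0\<close> gives the required orthogonality without any correction.\<close>
  define t where "t = - energy_form L A p r / energy_form L A p p"
  have tp: "L2_field L (\<lambda>x. t *\<^sub>R p x)" by (rule L2_field_scale[OF p])
  define w where "w = (\<lambda>x. r x + t *\<^sub>R p x)"
  have w: "L2_field L w" unfolding w_def by (rule L2_field_add[OF r tp])
  have wI: "energy_form L A (u j) w = 0" if "j \<in> I" for j
    unfolding w_def using a[OF that] b[OF that] uI[OF that] r tp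
    by (simp add: energy_form_add_right energy_form_scale_right flip: p_def r_def)
  have "energy_form L A p w = energy_form L A p r + t * energy_form L A p p"
    unfolding w_def using p r tp by (simp add: energy_form_add_right energy_form_scale_right)
  also have "\<dots> = 0" using energy_form_eq_0[OF p r] by (auto simp: t_def)
  finally have "energy_form L A p w = 0" .
  \<comment> \<open>Since \<open>w\<close> is orthogonal to the earlier fields, orthogonality to
    \<open>p\<close> and orthogonality to \<open>u k\<close> are the same.\<close>
  moreover have "energy_form L A p w = energy_form L A (u k) w + (\<Sum>i\<in>I. a i * energy_form L A (u i) w)"
  proof -
    have "L2_field L (\<lambda>x. \<Sum>i\<in>I. a i *\<^sub>R u i x)" using uI by (auto intro!: L2_field_sum L2_field_scale)
    then show ?thesis
      unfolding p_def using energy_form_sum_left[OF w insert.hyps(1) uI, where c = a]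
      by (simp add: energy_form_add_left w uk)
  qed
  ultimately have wk: "energy_form L A (u k) w = 0" using wI by simp
  define c where "c i = (if i = k then t else b i + t * a i)" for i
  have "w = (\<lambda>x. v x + (\<Sum>i\<in>insert k I. c i *\<^sub>R u i x))"
  proof
    fix x
    have "(\<Sum>i\<in>I. c i *\<^sub>R u i x) = (\<Sum>i\<in>I. b i *\<^sub>R u i x + t *\<^sub>R a i *\<^sub>R u i x)"
      using insert.hyps by (intro sum.cong) (auto simp: c_def scaleR_add_left)
    then show "w x = v x + (\<Sum>i\<in>insert k I. c i *\<^sub>R u i x)"
      using insert.hyps
      by (simp add: w_def r_def p_def sum.distrib scaleR_add_right scaleR_sum_right c_def)
  qed
  then show ?case using wI wk by (intro exI[of _ c]) auto
qed simp

end

section \<open>Correctors and the variational characterization\<close>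

lemma L2_field_cong_AE:
  fixes u v :: "real^'d \<Rightarrow> real^'d"
  assumes u: "L2_field L u" and v: "v \<in> borel_measurable (torus L)" and eq: "AE x in torus L. u x = v x"
  shows "L2_field L v"
  unfolding L2_field_def
proof (intro conjI v)
  have "AE x in torus L. (norm (u x))\<^sup>2 = (norm (v x))\<^sup>2" using eq by eventually_elim simp
  then have "integrable (torus L) (\<lambda>x. (norm (u x))\<^sup>2) \<longleftrightarrow> integrable (torus L) (\<lambda>x. (norm (v x))\<^sup>2)"
    using u v by (intro integrable_cong_AE) (auto simp: L2_field_def)
  then show "integrable (torus L) (\<lambda>x. (norm (v x))\<^sup>2)" using u by (simp add: L2_field_def)
qed

text \<open>Membership in \<open>torus_H1\<close> provides some square-integrable weak gradient,
  while \<open>weak_gradient\<close> may pick another one; uniqueness almost everywhere transfers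
  the integrability.\<close>

lemma weak_gradient_torus_H1:
  assumes L: "L \<ge> 1" and \<psi>: "\<psi> \<in> torus_H1 L"
  shows "has_weak_gradient L \<psi> (weak_gradient L \<psi>)" "L2_field L (weak_gradient L \<psi>)"
proof -
  obtain g where g: "has_weak_gradient L \<psi> g" and "integrable (torus L) (\<lambda>x. (norm (g x))\<^sup>2)"
    using \<psi> by (auto simp: torus_H1_def set_integrable_cell)
  then have "L2_field L g" by (auto simp: L2_field_def has_weak_gradient_torus)
  show 1: "has_weak_gradient L \<psi> (weak_gradient L \<psi>)"
    unfolding weak_gradient_def by (rule someI[of "has_weak_gradient L \<psi>", OF g])
  show "L2_field L (weak_gradient L \<psi>)"
    by (rule L2_field_cong_AE[OF \<open>L2_field L g\<close> _ has_weak_gradient_unique[OF L g 1]])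
      (use 1 in \<open>auto simp: has_weak_gradient_torus\<close>)
qed

locale torus_space =
  fixes L :: nat and X :: "(real^'d \<Rightarrow> real) set"
  assumes L: "L \<ge> 1" and X: "finite_dim_torus_space L X"
begin

lemma weak_gradient_X:
  assumes "\<psi> \<in> X"
  shows "has_weak_gradient L \<psi> (weak_gradient L \<psi>)" "L2_field L (weak_gradient L \<psi>)"
  using weak_gradient_torus_H1[OF L, of \<psi>] assms X by (auto simp: finite_dim_torus_space_def)

lemma sum_in_X:
  assumes "finite I" "\<And>i. i \<in> I \<Longrightarrow> \<psi> i \<in> X" shows "(\<lambda>x. \<Sum>i\<in>I. c i * \<psi> i x) \<in> X"
  using assms
proof (induction I rule: finite_induct)
  case empty
  then show ?case using X by (simp add: finite_dim_torus_space_def)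
next
  case (insert i I)
  have add: "\<forall>\<phi>\<in>X. \<forall>\<psi>\<in>X. (\<lambda>x. \<phi> x + \<psi> x) \<in> X"
    using X by (simp add: finite_dim_torus_space_def)
  have 1: "(\<lambda>x. c i * \<psi> i x) \<in> X" using insert.prems X by (simp add: finite_dim_torus_space_def)
  have 2: "(\<lambda>x. \<Sum>i\<in>I. c i * \<psi> i x) \<in> X" using insert by simp
  have "(\<lambda>x. c i * \<psi> i x + (\<Sum>i\<in>I. c i * \<psi> i x)) \<in> X"
    by (rule add[THEN bspec, OF 1, THEN bspec, OF 2])
  then show ?case using insert.hyps by simp
qed

lemma weak_gradient_sum:
  assumes "finite I" "\<And>i. i \<in> I \<Longrightarrow> \<psi> i \<in> X"
  shows "AE x in torus L. weak_gradient L (\<lambda>x. \<Sum>i\<in>I. c i * \<psi> i x) x = (\<Sum>i\<in>I. c i *\<^sub>R weak_gradient L (\<psi> i) x)"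
  by (rule has_weak_gradient_unique[OF L weak_gradient_X(1)[OF sum_in_X[OF assms]]
        has_weak_gradient_sum[OF assms(1) weak_gradient_X(1)[OF assms(2)]]]) auto

text \<open>A linear relation that holds almost everywhere between functions passes to their
  gradients by uniqueness. Only spanning is claimed: the gradients of \<open>B\<close> may be
  dependent, as with a constant function in \<open>B\<close>.\<close>

lemma weak_gradient_basis:
  obtains B where "finite B" "B \<subseteq> X"
    "\<And>\<psi>. \<psi> \<in> X \<Longrightarrow> \<exists>c. AE x in torus L. weak_gradient L \<psi> x = (\<Sum>b\<in>B. c b *\<^sub>R weak_gradient L b x)"
proof -
  have "\<exists>B. finite B \<and> B \<subseteq> X \<and> (\<forall>\<psi>\<in>X. \<exists>c. AE x in lebesgue. \<psi> x = (\<Sum>b\<in>B. c b * b x))"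
    using X by (simp add: finite_dim_torus_space_def)
  then obtain B where B: "finite B" "B \<subseteq> X"
    "\<forall>\<psi>\<in>X. \<exists>c. AE x in lebesgue. \<psi> x = (\<Sum>b\<in>B. c b * b x)"
    by (elim exE conjE) (rule that)
  have "\<exists>c. AE x in torus L. weak_gradient L \<psi> x = (\<Sum>b\<in>B. c b *\<^sub>R weak_gradient L b x)" if \<psi>: "\<psi> \<in> X" for \<psi>
  proof -
    obtain c where "AE x in lebesgue. \<psi> x = (\<Sum>b\<in>B. c b * b x)" using bspec[OF B(3) \<psi>] by (elim exE) (rule that)
    then have c: "AE x in torus L. \<psi> x = (\<Sum>b\<in>B. c b * b x)"
      by (simp add: AE_restrict_space_iff) (auto elim: eventually_mono)
    have "AE x in torus L. weak_gradient L \<psi> x = (\<Sum>b\<in>B. c b *\<^sub>R weak_gradient L b x)"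
      by (rule has_weak_gradient_unique[OF L weak_gradient_X(1)[OF \<psi>]
            has_weak_gradient_sum[OF B(1) weak_gradient_X(1)] c]) (use B in auto)
    then show ?thesis by blast
  qed
  with B(1,2) show ?thesis by (rule that)
qed

end

section \<open>Existence of correctors and the minimal energy\<close>

locale corrector_problem = torus_space L X + elliptic_field L \<alpha>\<^sub>0 \<beta>\<^sub>0 A
  for L :: nat and X :: "(real^'d \<Rightarrow> real) set" and \<alpha>\<^sub>0 \<beta>\<^sub>0
    and A :: "real^'d \<Rightarrow> real^'d^'d"
begin

lemma is_corrector_energy_form:
  "is_corrector L X A i \<phi> \<longleftrightarrow> \<phi> \<in> X \<and>
    (\<forall>\<psi>\<in>X. energy_form L A (weak_gradient L \<psi>) (\<lambda>x. axis i 1 + weak_gradient L \<phi> x) = 0)"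
  by (simp add: is_corrector_def energy_form_def set_lebesgue_integral_cell)

text \<open>Projecting the constant field \<open>axis i 1\<close> along the gradients of
  \<open>B\<close> yields coefficients, and the same combination of elements of \<open>B\<close> has
  the right gradient almost everywhere. Existence is what gives \<open>corrector\<close>, a choice,
  its defining property.\<close>

lemma ex_corrector: "\<exists>\<phi>. is_corrector L X A i \<phi>"
proof -
  obtain B where B: "finite B" "B \<subseteq> X" and span:
    "\<And>\<psi>. \<psi> \<in> X \<Longrightarrow> \<exists>c. AE x in torus L. weak_gradient L \<psi> x = (\<Sum>b\<in>B. c b *\<^sub>R weak_gradient L b x)"
    by (rule weak_gradient_basis) (rule that)
  let ?D = "weak_gradient L"
  have DB: "L2_field L (?D b)" if "b \<in> B" for b using weak_gradient_X B that by blast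
  have "\<exists>c. \<forall>b\<in>B. energy_form L A (?D b) (\<lambda>x. axis i 1 + (\<Sum>b\<in>B. c b *\<^sub>R ?D b x)) = 0"
    by (rule energy_projection[OF B(1) DB L2_field_const])
  then obtain c where c: "\<forall>b\<in>B. energy_form L A (?D b) (\<lambda>x. axis i 1 + (\<Sum>b\<in>B. c b *\<^sub>R ?D b x)) = 0"
    by (elim exE) (rule that)
  define \<phi> where "\<phi> = (\<lambda>x. \<Sum>b\<in>B. c b * b x)"
  have \<phi>: "\<phi> \<in> X" unfolding \<phi>_def using B by (intro sum_in_X) auto
  have D\<phi>: "AE x in torus L. ?D \<phi> x = (\<Sum>b\<in>B. c b *\<^sub>R ?D b x)"
    unfolding \<phi>_def using B by (intro weak_gradient_sum) auto
  have sum_L2: "L2_field L (\<lambda>x. \<Sum>b\<in>B. c b *\<^sub>R ?D b x)" for c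
    using DB by (intro L2_field_sum L2_field_scale)
  have w: "L2_field L (\<lambda>x. axis i 1 + ?D \<phi> x)"
    by (intro L2_field_add L2_field_const weak_gradient_X(2)[OF \<phi>])
  have b0: "energy_form L A (?D b) (\<lambda>x. axis i 1 + ?D \<phi> x) = 0" if "b \<in> B" for b
  proof -
    have "energy_form L A (?D b) (\<lambda>x. axis i 1 + ?D \<phi> x)
        = energy_form L A (?D b) (\<lambda>x. axis i 1 + (\<Sum>b\<in>B. c b *\<^sub>R ?D b x))"
      using D\<phi> by (intro energy_form_cong_AE w DB[OF that] L2_field_add L2_field_const sum_L2)
        (auto elim: eventually_mono)
    then show ?thesis using bspec[OF c that] by simp
  qed
  have "energy_form L A (?D \<psi>) (\<lambda>x. axis i 1 + ?D \<phi> x) = 0" if \<psi>: "\<psi> \<in> X" for \<psi>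
  proof -
    obtain a where "AE x in torus L. ?D \<psi> x = (\<Sum>b\<in>B. a b *\<^sub>R ?D b x)" using span[OF \<psi>] by (elim exE) (rule that)
    then have "energy_form L A (?D \<psi>) (\<lambda>x. axis i 1 + ?D \<phi> x)
        = energy_form L A (\<lambda>x. \<Sum>b\<in>B. a b *\<^sub>R ?D b x) (\<lambda>x. axis i 1 + ?D \<phi> x)"
      by (intro energy_form_cong_AE w sum_L2 weak_gradient_X(2)[OF \<psi>]) auto
    also have "\<dots> = 0" using b0 by (simp add: energy_form_sum_left[OF w B(1) DB])
    finally show ?thesis .
  qed
  then show ?thesis using \<phi> by (auto simp: is_corrector_energy_form)
qed

text \<open>The gradient of the corrected coordinate function, that is coordinate \<open>i\<close>
  plus its corrector; it is orthogonal in energy to all gradients from \<open>X\<close>.\<close>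

definition harmonic_field :: "'d \<Rightarrow> real^'d \<Rightarrow> real^'d"
  where "harmonic_field i x = axis i 1 + weak_gradient L (corrector L X A i) x"

lemma corrector_in_X: "corrector L X A i \<in> X"
  and energy_form_corrector: "\<psi> \<in> X \<Longrightarrow> energy_form L A (weak_gradient L \<psi>) (harmonic_field i) = 0"
proof -
  have "is_corrector L X A i (corrector L X A i)"
    unfolding corrector_def using ex_corrector by (rule someI_ex)
  then show "corrector L X A i \<in> X"
    and "\<psi> \<in> X \<Longrightarrow> energy_form L A (weak_gradient L \<psi>) (harmonic_field i) = 0"
    by (auto simp: is_corrector_energy_form harmonic_field_def[abs_def])
qed

lemma L2_field_harmonic_field: "L2_field L (harmonic_field i)"
  unfolding harmonic_field_def[abs_def]
  by (intro L2_field_add L2_field_const weak_gradient_X(2) corrector_in_X)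

text \<open>The corrector equation for direction \<open>i\<close>, tested with the corrector of
  direction \<open>j\<close>, adds zero and completes \<open>axis j 1\<close> to a harmonic field,
  which makes the entry a symmetric expression.\<close>

lemma Abar_entry: "Abar L X A $ i $ j = energy_form L A (harmonic_field i) (harmonic_field j)"
proof -
  have int: "integrable (torus L) (\<lambda>x. A x *v harmonic_field i x)"
  proof -
    have "integrable (torus L) (\<lambda>x. axis k 1 \<bullet> (A x *v harmonic_field i x))" for k
      by (rule integrable_energy[OF L2_field_const L2_field_harmonic_field])
    then have "integrable (torus L) (\<lambda>x. \<Sum>k\<in>UNIV. (axis k 1 \<bullet> (A x *v harmonic_field i x)) *\<^sub>R axis k (1::real))"
      by (intro Bochner_Integration.integrable_sum integrable_scaleR_left) auto
    moreover have "(\<Sum>k\<in>UNIV. (axis k 1 \<bullet> v) *\<^sub>R axis k (1::real)) = v" for v :: "real^'d"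
    proof -
      have "axis k 1 \<bullet> v = v $ k" for k by (simp add: inner_axis')
      then show ?thesis by (simp add: vec_eq_iff axis_def if_distrib cong: if_cong)
    qed
    ultimately show ?thesis by simp
  qed
  have "Abar L X A $ i $ j = axis j 1 \<bullet> (LINT x|torus L. A x *v harmonic_field i x)"
    by (simp add: Abar_def harmonic_field_def set_lebesgue_integral_cell)
  also have "\<dots> = energy_form L A (\<lambda>x. axis j 1) (harmonic_field i)"
    unfolding energy_form_def using int by (simp add: integral_inner_right)
  also have "\<dots> = energy_form L A (\<lambda>x. axis j 1) (harmonic_field i)
      + energy_form L A (weak_gradient L (corrector L X A j)) (harmonic_field i)"
    by (simp add: energy_form_corrector corrector_in_X)
  also have "\<dots> = energy_form L A (\<lambda>x. axis j 1 + weak_gradient L (corrector L X A j) x) (harmonic_field i)"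
    by (simp add: energy_form_add_left L2_field_harmonic_field L2_field_const weak_gradient_X corrector_in_X)
  also have "\<dots> = energy_form L A (harmonic_field i) (harmonic_field j)"
    by (subst energy_form_sym) (simp add: harmonic_field_def[abs_def])
  finally show ?thesis .
qed

lemma Abar_symmetric: "Abar L X A $ i $ j = Abar L X A $ j $ i"
  unfolding Abar_entry by (rule energy_form_sym)

lemma Abar_symmetric_inner: "\<eta> \<bullet> (Abar L X A *v \<xi>) = \<xi> \<bullet> (Abar L X A *v \<eta>)"
  unfolding inner_matrix_vector_expand
  by (subst sum.swap) (simp add: Abar_symmetric mult_ac)

text \<open>For given \<open>\<xi>\<close>, the effective energy is the minimal energy over affine functions of slope \<open>\<xi>\<close>
  perturbed by \<open>X\<close>.\<close>

lemma
  shows Abar_minimal: "\<And>\<psi>. \<psi> \<in> X \<Longrightarrow> \<xi> \<bullet> (Abar L X A *v \<xi>)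
      \<le> energy_form L A (\<lambda>x. \<xi> + weak_gradient L \<psi> x) (\<lambda>x. \<xi> + weak_gradient L \<psi> x)"
    and Abar_attained: "\<exists>\<psi>\<in>X. \<xi> \<bullet> (Abar L X A *v \<xi>)
      = energy_form L A (\<lambda>x. \<xi> + weak_gradient L \<psi> x) (\<lambda>x. \<xi> + weak_gradient L \<psi> x)"
proof -
  let ?D = "weak_gradient L" and ?G = "energy_form L A"
  \<comment> \<open>By linearity this combination of correctors is the corrector for slope
    \<open>\<xi>\<close>; its gradient equals \<open>h - \<xi>\<close> only almost
    everywhere.\<close>
  define \<phi> where "\<phi> = (\<lambda>x. \<Sum>i\<in>UNIV. \<xi> $ i * corrector L X A i x)"
  define h where "h = (\<lambda>x. \<Sum>i\<in>UNIV. \<xi> $ i *\<^sub>R harmonic_field i x)"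
  have \<phi>: "\<phi> \<in> X" unfolding \<phi>_def by (intro sum_in_X corrector_in_X) auto
  have h: "L2_field L h" unfolding h_def by (intro L2_field_sum L2_field_scale L2_field_harmonic_field)
  have \<xi>D: "L2_field L (\<lambda>x. \<xi> + ?D \<psi> x)" if "\<psi> \<in> X" for \<psi>
    by (intro L2_field_add L2_field_const weak_gradient_X that)
  have "AE x in torus L. ?D \<phi> x = (\<Sum>i\<in>UNIV. \<xi> $ i *\<^sub>R ?D (corrector L X A i) x)"
    unfolding \<phi>_def by (intro weak_gradient_sum corrector_in_X) auto
  then have eq: "AE x in torus L. \<xi> + ?D \<phi> x = h x"
  proof eventually_elim
    case (elim x)
    have "h x = (\<Sum>i\<in>UNIV. \<xi> $ i *\<^sub>R axis i 1) + (\<Sum>i\<in>UNIV. \<xi> $ i *\<^sub>R ?D (corrector L X A i) x)"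
      by (simp add: h_def harmonic_field_def scaleR_add_right sum.distrib)
    also have "(\<Sum>i\<in>UNIV. \<xi> $ i *\<^sub>R axis i (1::real)) = \<xi>"
      by (simp add: vec_eq_iff axis_def if_distrib cong: if_cong)
    finally show ?case using elim by simp
  qed
  have D_orth: "?G (?D \<psi>) h = 0" if "\<psi> \<in> X" for \<psi>
    unfolding h_def using that
    by (simp add: energy_form_sum_right weak_gradient_X L2_field_harmonic_field energy_form_corrector)
  have left: "?G h u = (\<Sum>i\<in>UNIV. \<xi> $ i * ?G (harmonic_field i) u)" if "L2_field L u" for u
    unfolding h_def by (rule energy_form_sum_left[OF that]) (auto intro: L2_field_harmonic_field)
  have right: "?G u h = (\<Sum>i\<in>UNIV. \<xi> $ i * ?G u (harmonic_field i))" if "L2_field L u" for u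
    unfolding h_def by (rule energy_form_sum_right[OF that]) (auto intro: L2_field_harmonic_field)
  have "?G h h = (\<Sum>i\<in>UNIV. \<xi> $ i * (\<Sum>j\<in>UNIV. \<xi> $ j * ?G (harmonic_field i) (harmonic_field j)))"
    by (simp add: left[OF h] right L2_field_harmonic_field)
  also have "\<dots> = \<xi> \<bullet> (Abar L X A *v \<xi>)"
    by (simp add: inner_matrix_vector_expand Abar_entry sum_distrib_left mult_ac)
  finally have hh: "?G h h = \<xi> \<bullet> (Abar L X A *v \<xi>)" .
  have "?G (\<lambda>x. \<xi> + ?D \<phi> x) (\<lambda>x. \<xi> + ?D \<phi> x) = ?G h h"
    using eq by (intro energy_form_cong_AE \<xi>D \<phi> h)
  with hh \<phi> show "\<exists>\<psi>\<in>X. \<xi> \<bullet> (Abar L X A *v \<xi>) = ?G (\<lambda>x. \<xi> + ?D \<psi> x) (\<lambda>x. \<xi> + ?D \<psi> x)"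
    by (intro bexI[of _ \<phi>]) auto
  fix \<psi> assume \<psi>: "\<psi> \<in> X"
  \<comment> \<open>The deviation of the competitor from the minimizer. It is orthogonal to
    \<open>h\<close>, so the energies add as in the theorem of Pythagoras.\<close>
  define \<delta> where "\<delta> = (\<lambda>x. ?D \<psi> x + (- 1) *\<^sub>R ?D \<phi> x)"
  have m\<phi>: "L2_field L (\<lambda>x. (- 1) *\<^sub>R ?D \<phi> x)" by (intro L2_field_scale weak_gradient_X \<phi>)
  have \<delta>: "L2_field L \<delta>" unfolding \<delta>_def by (intro L2_field_add weak_gradient_X \<psi> m\<phi>)
  have "?G h \<delta> = ?G h (?D \<psi>) + ?G h (\<lambda>x. (- 1) *\<^sub>R ?D \<phi> x)"
    unfolding \<delta>_def by (rule energy_form_add_right[OF h weak_gradient_X(2)[OF \<psi>] m\<phi>])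
  then have \<delta>h: "?G h \<delta> = 0"
    using D_orth[OF \<psi>] D_orth[OF \<phi>]
    unfolding energy_form_scale_right by (simp add: energy_form_sym[of h])
  have "?G (\<lambda>x. \<xi> + ?D \<psi> x) (\<lambda>x. \<xi> + ?D \<psi> x) = ?G (\<lambda>x. h x + \<delta> x) (\<lambda>x. h x + \<delta> x)"
  proof -
    have "AE x in torus L. \<xi> + ?D \<psi> x = h x + \<delta> x"
      using eq
    proof eventually_elim
      case (elim x)
      then show ?case by (simp add: \<delta>_def elim[symmetric])
    qed
    then show ?thesis by (intro energy_form_cong_AE \<xi>D \<psi> L2_field_add h \<delta>)
  qed
  also have "\<dots> = ?G h h + ?G \<delta> \<delta>"
    by (simp add: energy_form_add_left energy_form_add_right L2_field_add h \<delta> \<delta>h energy_form_sym[of \<delta> h])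
  also have "\<dots> \<ge> ?G h h" using energy_form_nonneg[of \<delta>] by simp
  finally show "\<xi> \<bullet> (Abar L X A *v \<xi>) \<le> ?G (\<lambda>x. \<xi> + ?D \<psi> x) (\<lambda>x. \<xi> + ?D \<psi> x)"
    by (simp add: hh)
qed

end

section \<open>Rotation of coefficient fields\<close>

definition rotate_field :: "real^'d^'d \<Rightarrow> (real^'d \<Rightarrow> real^'d^'d) \<Rightarrow> real^'d \<Rightarrow> real^'d^'d"
  where "rotate_field R A = (\<lambda>x. transpose R ** A (R *v x) ** R)"

lemma inner_rotate_field:
  "u \<bullet> (rotate_field R A x *v v) = (R *v u) \<bullet> (A (R *v x) *v (R *v v))"
  unfolding rotate_field_def
  by (simp flip: matrix_vector_mul_assoc add: inner_matrix_transpose)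

lemma rotate_field_entry:
  fixes R :: "real^'d^'d"
  shows "rotate_field R A x $ i $ j = (\<Sum>k\<in>UNIV. \<Sum>l\<in>UNIV. R $ k $ i * R $ l $ j * A (R *v x) $ k $ l)"
proof -
  have "rotate_field R A x $ i $ j = (\<Sum>l\<in>UNIV. \<Sum>k\<in>UNIV. R $ k $ i * R $ l $ j * A (R *v x) $ k $ l)"
    by (simp add: rotate_field_def matrix_matrix_mult_def transpose_def sum_distrib_left sum_distrib_right mult_ac)
  then show ?thesis by (subst sum.swap)
qed

lemma rotate_field_inverse:
  assumes "R \<in> cube_group" shows "rotate_field (transpose R) (rotate_field R A) = A"
proof
  fix x
  have "rotate_field (transpose R) (rotate_field R A) x
      = (R ** transpose R) ** A (R *v (transpose R *v x)) ** (R ** transpose R)"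
    by (simp add: rotate_field_def matrix_mul_assoc)
  then show "rotate_field (transpose R) (rotate_field R A) x = A x"
    using assms by (simp add: cube_group_inverse(2))
qed

lemma rotate_field_in_coeff_fields:
  fixes R :: "real^'d^'d"
  assumes R: "R \<in> cube_group" and A: "A \<in> coeff_fields L \<alpha>\<^sub>0 \<beta>\<^sub>0"
  shows "rotate_field R A \<in> coeff_fields L \<alpha>\<^sub>0 \<beta>\<^sub>0"
proof -
  have per: "periodic L A" and meas: "A \<in> borel_measurable lebesgue"
    and sym: "\<And>x. transpose (A x) = A x"
    and bds: "\<And>x \<xi>. \<alpha>\<^sub>0 * (\<xi> \<bullet> \<xi>) \<le> \<xi> \<bullet> (A x *v \<xi>)" "\<And>x \<xi>. \<xi> \<bullet> (A x *v \<xi>) \<le> \<beta>\<^sub>0 * (\<xi> \<bullet> \<xi>)"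
    using A by (auto simp: coeff_fields_def)
  have "periodic L (rotate_field R A)"
    using periodic_rotation[OF R per] by (simp add: periodic_def rotate_field_def)
  moreover have "rotate_field R A \<in> borel_measurable lebesgue"
  proof -
    \<comment> \<open>Periodicity allows the rotation about the cell centre in place of
      \<open>R\<close>; for that map measurability with respect to Lebesgue sets is known.\<close>
    have "(\<lambda>x. A (cell_rotation L R x)) \<in> borel_measurable lebesgue"
      by (rule measurable_compose[OF measurable_cell_rotation[OF R] meas])
    then have m: "(\<lambda>x. A (R *v x)) \<in> borel_measurable lebesgue"
      by (simp add: periodic_cell_rotation[OF R per])
    have "linear (\<lambda>B. transpose R ** B ** R)"
      by (rule linearI) (simp_all add: vec_eq_iff matrix_matrix_mult_def algebra_simps
        sum.distrib sum_distrib_left sum_distrib_right)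
    then have "continuous_on UNIV (\<lambda>B. transpose R ** B ** R)"
      by (rule linear_continuous_on[OF linear_conv_bounded_linear[THEN iffD1]])
    then have "(\<lambda>B. transpose R ** B ** R) \<in> borel_measurable borel"
      by (rule borel_measurable_continuous_onI)
    then show ?thesis unfolding rotate_field_def by (rule measurable_compose[OF m])
  qed
  moreover have "transpose (rotate_field R A x) = rotate_field R A x" for x
    by (simp add: rotate_field_def matrix_transpose_mul sym matrix_mul_assoc)
  moreover have "(R *v \<xi>) \<bullet> (R *v \<xi>) = \<xi> \<bullet> \<xi>" for \<xi>
    using R by (simp flip: inner_matrix_transpose)
  ultimately show ?thesis
    using bds by (simp add: coeff_fields_def inner_rotate_field) metis
qed

text \<open>The transposes cancel, so the integrand at \<open>x\<close> is the original one at
  \<open>R *v x\<close>.\<close>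

lemma energy_form_rotate:
  fixes u v :: "real^'d \<Rightarrow> real^'d"
  assumes R: "R \<in> cube_group" and "elliptic_field L \<alpha>\<^sub>0 \<beta>\<^sub>0 A"
    and u: "L2_field L u" "periodic L u" and v: "L2_field L v" "periodic L v"
  shows "energy_form L (rotate_field R A) (\<lambda>x. transpose R *v u (R *v x)) (\<lambda>x. transpose R *v v (R *v x))
    = energy_form L A u v"
proof -
  interpret elliptic_field L \<alpha>\<^sub>0 \<beta>\<^sub>0 A by fact
  have per: "periodic L (\<lambda>x. u x \<bullet> (A x *v v x))"
    using u(2) v(2) coeff by (simp add: coeff_fields_def periodic_def)
  show ?thesis
    unfolding energy_form_def inner_rotate_field
    using integral_rotation[OF R per borel_measurable_integrable[OF integrable_energy[OF u(1) v(1)]]] R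
    by simp
qed

lemma (in torus_space) weak_gradient_rotation:
  assumes R: "R \<in> cube_group" and \<psi>: "\<psi> \<in> X" "(\<lambda>x. \<psi> (R *v x)) \<in> X"
  shows "AE x in torus L. weak_gradient L (\<lambda>x. \<psi> (R *v x)) x = transpose R *v weak_gradient L \<psi> (R *v x)"
  by (rule has_weak_gradient_unique[OF L weak_gradient_X(1)[OF \<psi>(2)]
        has_weak_gradient_rotation[OF R weak_gradient_X(1)[OF \<psi>(1)]]]) simp

locale invariant_corrector_problem = corrector_problem +
  assumes X_invariant: "R \<in> cube_group \<Longrightarrow> \<psi> \<in> X \<Longrightarrow> (\<lambda>x. \<psi> (R *v x)) \<in> X"
begin

text \<open>If \<open>\<psi>\<close> is optimal for \<open>A\<close> and the slope
  \<open>R *v \<xi>\<close>, then \<open>\<psi>\<close> composed with \<open>R\<close> competes for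
  the rotated field and the slope \<open>\<xi>\<close> with the same energy. A competitor gives an
  inequality only.\<close>

lemma Abar_rotate_le:
  assumes R: "R \<in> cube_group"
  shows "\<xi> \<bullet> (Abar L X (rotate_field R A) *v \<xi>) \<le> (R *v \<xi>) \<bullet> (Abar L X A *v (R *v \<xi>))"
proof -
  interpret rot: corrector_problem L X \<alpha>\<^sub>0 \<beta>\<^sub>0 "rotate_field R A"
    by unfold_locales (rule rotate_field_in_coeff_fields[OF R coeff], rule ellipticity)
  let ?D = "weak_gradient L"
  obtain \<psi> where \<psi>: "\<psi> \<in> X" and min: "(R *v \<xi>) \<bullet> (Abar L X A *v (R *v \<xi>))
      = energy_form L A (\<lambda>x. R *v \<xi> + ?D \<psi> x) (\<lambda>x. R *v \<xi> + ?D \<psi> x)"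
    using Abar_attained[of "R *v \<xi>"] by (elim bexE) (rule that)
  let ?u = "\<lambda>x. R *v \<xi> + ?D \<psi> x" and ?\<psi> = "\<lambda>x. \<psi> (R *v x)"
  have u: "L2_field L ?u" by (intro L2_field_add L2_field_const weak_gradient_X \<psi>)
  have per: "periodic L ?u"
    using weak_gradient_X(1)[OF \<psi>] by (simp add: has_weak_gradient_torus periodic_def)
  have \<psi>R: "?\<psi> \<in> X" by (rule X_invariant[OF R \<psi>])
  have uR: "L2_field L (\<lambda>x. \<xi> + ?D ?\<psi> x)" by (intro L2_field_add L2_field_const weak_gradient_X \<psi>R)
  have eq: "AE x in torus L. \<xi> + ?D ?\<psi> x = transpose R *v ?u (R *v x)"
    using weak_gradient_rotation[OF R \<psi> \<psi>R]
    by eventually_elim (use R in \<open>simp add: matrix_vector_right_distrib\<close>)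
  \<comment> \<open>Square-integrability is inherited from the almost everywhere equal field in
    \<open>uR\<close>; only measurability has to be checked.\<close>
  have uR': "L2_field L (\<lambda>x. transpose R *v ?u (R *v x))"
  proof (rule L2_field_cong_AE[OF uR _ eq])
    have "(\<lambda>x. ?u (R *v x)) \<in> borel_measurable (torus L)"
      using u by (intro borel_measurable_rotation[OF R per]) (simp add: L2_field_def)
    then show "(\<lambda>x. transpose R *v ?u (R *v x)) \<in> borel_measurable (torus L)"
      by (rule measurable_compose[OF _ borel_measurable_continuous_onI[OF
            linear_continuous_on[OF matrix_vector_mul_bounded_linear]]])
  qed
  have "\<xi> \<bullet> (Abar L X (rotate_field R A) *v \<xi>)
      \<le> energy_form L (rotate_field R A) (\<lambda>x. \<xi> + ?D ?\<psi> x) (\<lambda>x. \<xi> + ?D ?\<psi> x)"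
    by (rule rot.Abar_minimal[OF \<psi>R])
  also have "\<dots> = energy_form L (rotate_field R A) (\<lambda>x. transpose R *v ?u (R *v x)) (\<lambda>x. transpose R *v ?u (R *v x))"
    by (rule rot.energy_form_cong_AE[OF uR uR' uR uR' eq eq])
  also have "\<dots> = energy_form L A ?u ?u"
    by (rule energy_form_rotate[OF R elliptic_field_axioms u per u per])
  finally show ?thesis by (simp add: min)
qed

text \<open>The inequality for \<open>transpose R\<close> and the rotated field is the reverse one,
  since rotating back restores \<open>A\<close>.\<close>

lemma quadratic_Abar_rotate:
  assumes R: "R \<in> cube_group"
  shows "\<xi> \<bullet> (Abar L X (rotate_field R A) *v \<xi>) = (R *v \<xi>) \<bullet> (Abar L X A *v (R *v \<xi>))"
proof (rule antisym[OF Abar_rotate_le[OF R]])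
  interpret rot: invariant_corrector_problem L X \<alpha>\<^sub>0 \<beta>\<^sub>0 "rotate_field R A"
    by unfold_locales (rule rotate_field_in_coeff_fields[OF R coeff], rule ellipticity, rule X_invariant)
  show "(R *v \<xi>) \<bullet> (Abar L X A *v (R *v \<xi>)) \<le> \<xi> \<bullet> (Abar L X (rotate_field R A) *v \<xi>)"
    using rot.Abar_rotate_le[OF cube_group_transpose[OF R], of "R *v \<xi>"] R
    by (simp add: rotate_field_inverse)
qed

end

text \<open>Symmetry of \<open>Abar\<close> lets its quadratic form determine the bilinear one; what
  minimization proves about energies reaches the entries this way.\<close>

lemma (in corrector_problem) Abar_polarization:
  "\<eta> \<bullet> (Abar L X A *v \<xi>) = ((\<eta> + \<xi>) \<bullet> (Abar L X A *v (\<eta> + \<xi>)) - (\<eta> - \<xi>) \<bullet> (Abar L X A *v (\<eta> - \<xi>))) / 4"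
  using Abar_symmetric_inner[of \<xi> \<eta>]
  by (simp add: matrix_vector_right_distrib matrix_vector_mult_diff_distrib inner_add_left inner_add_right
    inner_diff_left inner_diff_right)

lemma (in invariant_corrector_problem) Abar_rotate:
  assumes R: "R \<in> cube_group"
  shows "\<eta> \<bullet> (Abar L X (rotate_field R A) *v \<xi>) = (R *v \<eta>) \<bullet> (Abar L X A *v (R *v \<xi>))"
proof -
  interpret rot: corrector_problem L X \<alpha>\<^sub>0 \<beta>\<^sub>0 "rotate_field R A"
    by unfold_locales (rule rotate_field_in_coeff_fields[OF R coeff], rule ellipticity)
  show ?thesis
    unfolding Abar_polarization[of "R *v \<eta>" "R *v \<xi>"] rot.Abar_polarization[of \<eta> \<xi>]
      quadratic_Abar_rotate[OF R]
    by (simp add: matrix_vector_right_distrib matrix_vector_mult_diff_distrib)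
qed

text \<open>The competitor 0 bounds the minimal energy from above, positivity from below. The chosen
  weak gradient of 0 vanishes only almost everywhere and is left in place, as all that matters is a
  bound independent of \<open>A\<close>.\<close>

lemma (in corrector_problem) Abar_bound:
  "\<bar>\<eta> \<bullet> (Abar L X A *v \<xi>)\<bar> \<le> \<beta>\<^sub>0 * (LINT x|torus L. (norm (\<eta> + \<xi> + weak_gradient L (\<lambda>x. 0) x))\<^sup>2)
    + \<beta>\<^sub>0 * (LINT x|torus L. (norm (\<eta> - \<xi> + weak_gradient L (\<lambda>x. 0) x))\<^sup>2)"
proof -
  have 0: "(\<lambda>x. 0) \<in> X" using X by (simp add: finite_dim_torus_space_def)
  let ?u = "\<lambda>(\<zeta>::real^'d) x. \<zeta> + weak_gradient L (\<lambda>x. 0) x"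
  have u: "L2_field L (?u \<zeta>)" for \<zeta> by (intro L2_field_add L2_field_const weak_gradient_X 0)
  have up: "\<zeta> \<bullet> (Abar L X A *v \<zeta>) \<le> \<beta>\<^sub>0 * (LINT x|torus L. (norm (?u \<zeta> x))\<^sup>2)" for \<zeta>
  proof -
    have "\<zeta> \<bullet> (Abar L X A *v \<zeta>) \<le> energy_form L A (?u \<zeta>) (?u \<zeta>)" by (rule Abar_minimal[OF 0])
    also have "\<dots> \<le> (LINT x|torus L. \<beta>\<^sub>0 * (norm (?u \<zeta> x))\<^sup>2)"
      unfolding energy_form_def
    proof (rule integral_mono[OF integrable_energy[OF u u]])
      show "integrable (torus L) (\<lambda>x. \<beta>\<^sub>0 * (norm (?u \<zeta> x))\<^sup>2)" using u by (simp add: L2_field_def)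
      show "?u \<zeta> x \<bullet> (A x *v ?u \<zeta> x) \<le> \<beta>\<^sub>0 * (norm (?u \<zeta> x))\<^sup>2" for x
        using bounds(2)[of "?u \<zeta> x" x] by (simp add: power2_norm_eq_inner)
    qed
    finally show ?thesis by simp
  qed
  have lo: "0 \<le> \<zeta> \<bullet> (Abar L X A *v \<zeta>)" for \<zeta>
    using Abar_attained[of \<zeta>] energy_form_nonneg by auto
  have "\<bar>(p - q) / 4\<bar> \<le> P + Q" if "0 \<le> p" "0 \<le> q" "p \<le> P" "q \<le> Q" for p q P Q :: real
    using that by (auto simp: abs_le_iff field_simps)
  then show ?thesis
    unfolding Abar_polarization[of \<eta> \<xi>] by this (rule lo up)+
qed

section \<open>Measurability\<close>

locale random_field =
  fixes L :: nat and \<alpha>\<^sub>0 \<beta>\<^sub>0 :: real and M :: "(real^'d \<Rightarrow> real^'d^'d) measure"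
  assumes L: "L \<ge> 1" and ellipticity: "0 < \<alpha>\<^sub>0" and ens: "ensemble L \<alpha>\<^sub>0 \<beta>\<^sub>0 M"
begin

lemma sets_M: "sets M = sigma_sets (coeff_fields L \<alpha>\<^sub>0 \<beta>\<^sub>0)
    {{A \<in> coeff_fields L \<alpha>\<^sub>0 \<beta>\<^sub>0. (LINT x:cell L|lebesgue. w x * A x $ i $ j) \<in> S} | w i j S.
      set_integrable lebesgue (cell L) w \<and> S \<in> sets borel}"
  using ens unfolding ensemble_def coeff_space_def by (simp only:) (rule sets_measure_of, blast)

lemma space_M: "space M = coeff_fields L \<alpha>\<^sub>0 \<beta>\<^sub>0"
proof -
  have "space M = space (coeff_space L \<alpha>\<^sub>0 \<beta>\<^sub>0)"
    using ens sets_eq_imp_space_eq by (auto simp: ensemble_def)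
  also have "\<dots> = coeff_fields L \<alpha>\<^sub>0 \<beta>\<^sub>0"
    unfolding coeff_space_def by (rule space_measure_of) blast
  finally show ?thesis .
qed

lemma elliptic: "A \<in> space M \<Longrightarrow> elliptic_field L \<alpha>\<^sub>0 \<beta>\<^sub>0 A"
  using ellipticity by (simp add: space_M elliptic_field_def)

lemma measurable_average:
  assumes w: "integrable (torus L) w"
  shows "(\<lambda>A. LINT x|torus L. w x * A x $ i $ j) \<in> borel_measurable M"
proof (rule measurableI)
  fix S :: "real set" assume S: "S \<in> sets borel"
  let ?E = "{A \<in> coeff_fields L \<alpha>\<^sub>0 \<beta>\<^sub>0. (LINT x:cell L|lebesgue. w x * A x $ i $ j) \<in> S}"
  have "?E \<in> sets M"
    unfolding sets_M by (rule sigma_sets.Basic) (use w S in \<open>auto simp: set_integrable_cell\<close>)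
  moreover have "(\<lambda>A. LINT x|torus L. w x * A x $ i $ j) -` S \<inter> space M = ?E"
    by (auto simp: space_M set_lebesgue_integral_cell)
  ultimately show "(\<lambda>A. LINT x|torus L. w x * A x $ i $ j) -` S \<inter> space M \<in> sets M" by simp
qed simp

text \<open>The energy is a finite sum of averages of entries against integrable weights, and
  exactly such averages generate the sigma-algebra.\<close>

lemma measurable_energy_form:
  assumes u: "L2_field L u" and v: "L2_field L v"
  shows "(\<lambda>A. energy_form L A u v) \<in> borel_measurable M"
proof -
  have "(\<lambda>A. \<Sum>i\<in>UNIV. \<Sum>j\<in>UNIV. LINT x|torus L. u x $ i * v x $ j * A x $ i $ j) \<in> borel_measurable M"
    by (intro borel_measurable_sum measurable_average integrable_L2_field_mult u v)
  then show ?thesis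
    by (rule measurable_cong[THEN iffD2, rotated])
      (rule elliptic_field.energy_form_expand[OF elliptic u v])
qed

text \<open>The rotation is moved from the field to the weight. The weight need not be periodic, so
  it is composed with the rotation about the cell centre, which the periodic field does not
  distinguish from \<open>R\<close>.\<close>

lemma integral_rotate_field_entry:
  assumes R: "R \<in> cube_group" and A: "A \<in> space M" and w: "integrable (torus L) w"
  shows "(LINT x|torus L. w x * rotate_field R A x $ i $ j)
    = (\<Sum>k\<in>UNIV. \<Sum>l\<in>UNIV. R $ k $ i * R $ l $ j *
        (LINT x|torus L. w (cell_rotation L (transpose R) x) * A x $ k $ l))"
proof -
  interpret elliptic_field L \<alpha>\<^sub>0 \<beta>\<^sub>0 A by (rule elliptic[OF A])
  note Rt = cube_group_transpose[OF R]
  have per: "periodic L A" using coeff by (simp add: coeff_fields_def)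
  have w': "integrable (torus L) (\<lambda>x. w (cell_rotation L (transpose R) x))"
    using integrable_cell_rotation[OF Rt, of w L] w by simp
  let ?f = "\<lambda>k l y. w (cell_rotation L (transpose R) y) * A y $ k $ l"
  have f: "integrable (torus L) (?f k l)" for k l by (rule integrable_weight_entry[OF w'])
  have fR: "?f k l (cell_rotation L R x) = w x * A (R *v x) $ k $ l" for k l x
    using R by (simp add: periodic_cell_rotation[OF R per])
  have i: "integrable (torus L) (\<lambda>x. w x * A (R *v x) $ k $ l)" for k l
    using integrable_cell_rotation[OF R, of "?f k l" L] f[of k l] unfolding fR by simp
  have e: "(LINT x|torus L. w x * A (R *v x) $ k $ l) = integral\<^sup>L (torus L) (?f k l)" for k l
    using integral_cell_rotation[OF R, of "?f k l" L] f[of k l] unfolding fR by simp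
  have "(LINT x|torus L. w x * rotate_field R A x $ i $ j)
      = (LINT x|torus L. (\<Sum>k\<in>UNIV. \<Sum>l\<in>UNIV. (R $ k $ i * R $ l $ j) * (w x * A (R *v x) $ k $ l)))"
    by (simp add: rotate_field_entry sum_distrib_left mult_ac)
  also have "\<dots> = (\<Sum>k\<in>UNIV. \<Sum>l\<in>UNIV. R $ k $ i * R $ l $ j * (LINT x|torus L. w x * A (R *v x) $ k $ l))"
    using i by (simp add: Bochner_Integration.integral_sum)
  finally show ?thesis by (simp add: e)
qed

text \<open>It suffices to treat generating sets, where averages of the rotated field are linear
  combinations of averages of the field with transported weights.\<close>

lemma measurable_rotate_field:
  assumes R: "R \<in> cube_group" shows "rotate_field R \<in> M \<rightarrow>\<^sub>M M"
proof (rule measurable_sigma_sets[OF sets_M])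
  show "rotate_field R \<in> space M \<rightarrow> coeff_fields L \<alpha>\<^sub>0 \<beta>\<^sub>0"
    using rotate_field_in_coeff_fields[OF R] by (auto simp: space_M)
  fix E :: "(real^'d \<Rightarrow> real^'d^'d) set" assume "E \<in> {{A \<in> coeff_fields L \<alpha>\<^sub>0 \<beta>\<^sub>0. (LINT x:cell L|lebesgue. w x * A x $ i $ j) \<in> S} | w i j S.
      set_integrable lebesgue (cell L) w \<and> S \<in> sets borel}"
  then obtain w :: "real^'d \<Rightarrow> real" and i j S where E: "E = {A \<in> coeff_fields L \<alpha>\<^sub>0 \<beta>\<^sub>0. (LINT x|torus L. w x * A x $ i $ j) \<in> S}"
    and w: "integrable (torus L) w" and S: "S \<in> sets borel"
    by (auto simp: set_integrable_cell set_lebesgue_integral_cell)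
  have w': "integrable (torus L) (\<lambda>x. w (cell_rotation L (transpose R) x))"
    using integrable_cell_rotation[OF cube_group_transpose[OF R], of w L] w by simp
  have "(\<lambda>A. \<Sum>k\<in>UNIV. \<Sum>l\<in>UNIV. R $ k $ i * R $ l $ j *
        (LINT x|torus L. w (cell_rotation L (transpose R) x) * A x $ k $ l)) \<in> borel_measurable M"
    by (intro borel_measurable_sum borel_measurable_times borel_measurable_const measurable_average w')
  then have "(\<lambda>A. LINT x|torus L. w x * rotate_field R A x $ i $ j) \<in> borel_measurable M"
    by (rule measurable_cong[THEN iffD2, rotated]) (rule integral_rotate_field_entry[OF R _ w])
  then have "(\<lambda>A. LINT x|torus L. w x * rotate_field R A x $ i $ j) -` S \<inter> space M \<in> sets M"
    using S by (rule measurable_sets)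
  moreover have "rotate_field R -` E \<inter> space M = (\<lambda>A. LINT x|torus L. w x * rotate_field R A x $ i $ j) -` S \<inter> space M"
    using rotate_field_in_coeff_fields[OF R] by (auto simp: E space_M)
  ultimately show "rotate_field R -` E \<inter> space M \<in> sets M" by simp
qed blast

end

section \<open>Measurability and boundedness of the effective matrix\<close>

locale random_corrector = torus_space L X + random_field L \<alpha>\<^sub>0 \<beta>\<^sub>0 M
  for L and X :: "(real^'d \<Rightarrow> real) set" and \<alpha>\<^sub>0 \<beta>\<^sub>0 and M :: "(real^'d \<Rightarrow> real^'d^'d) measure"
begin

lemma corrector_problem: "A \<in> space M \<Longrightarrow> corrector_problem L X \<alpha>\<^sub>0 \<beta>\<^sub>0 A"
  using elliptic torus_space_axioms by (simp add: corrector_problem_def)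

text \<open>By continuity, the minimum over \<open>X\<close> is an infimum over countably many rational combinations
  of a basis.\<close>

lemma measurable_quadratic_Abar: "(\<lambda>A. \<xi> \<bullet> (Abar L X A *v \<xi>)) \<in> borel_measurable M"
proof -
  let ?D = "weak_gradient L"
  obtain B where B: "finite B" "B \<subseteq> X" and span:
    "\<And>\<psi>. \<psi> \<in> X \<Longrightarrow> \<exists>c. AE x in torus L. ?D \<psi> x = (\<Sum>b\<in>B. c b *\<^sub>R ?D b x)"
    by (rule weak_gradient_basis) (rule that)
  define u where "u c = (\<lambda>x. \<xi> + (\<Sum>b\<in>B. c b *\<^sub>R ?D b x))" for c
  have DB: "L2_field L (?D b)" if "b \<in> B" for b using weak_gradient_X(2)[OF subsetD[OF B(2) that]] .
  have S: "L2_field L (\<lambda>x. \<Sum>b\<in>B. c b *\<^sub>R ?D b x)" for c using DB by (intro L2_field_sum L2_field_scale)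
  have u: "L2_field L (u c)" for c unfolding u_def by (intro L2_field_add L2_field_const S)
  let ?F = "\<lambda>c A. energy_form L A (u c) (u c)" and ?q = "\<lambda>A. \<xi> \<bullet> (Abar L X A *v \<xi>)"
  \<comment> \<open>\<open>PiE\<close> fixes the values outside \<open>B\<close>, so that the
    rational coefficient families on the finite set \<open>B\<close> form a countable set.\<close>
  define C where "C = PiE B (\<lambda>_. \<rat> :: real set)"
  have C: "countable C" unfolding C_def by (intro countable_PiE B countable_rat)
  have le: "?q A \<le> ?F c A" if A: "A \<in> space M" for A c
  proof -
    interpret corrector_problem L X \<alpha>\<^sub>0 \<beta>\<^sub>0 A by (rule corrector_problem[OF A])
    let ?\<psi> = "\<lambda>x. \<Sum>b\<in>B. c b * b x"
    have \<psi>: "?\<psi> \<in> X" using B by (intro sum_in_X) auto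
    have u\<psi>: "L2_field L (\<lambda>x. \<xi> + ?D ?\<psi> x)" by (intro L2_field_add L2_field_const weak_gradient_X \<psi>)
    have "AE x in torus L. ?D ?\<psi> x = (\<Sum>b\<in>B. c b *\<^sub>R ?D b x)" using B by (intro weak_gradient_sum) auto
    then have "AE x in torus L. \<xi> + ?D ?\<psi> x = u c x" by eventually_elim (simp add: u_def)
    then have "energy_form L A (\<lambda>x. \<xi> + ?D ?\<psi> x) (\<lambda>x. \<xi> + ?D ?\<psi> x) = ?F c A"
      by (intro energy_form_cong_AE u u\<psi>)
    then show ?thesis using Abar_minimal[OF \<psi>, of \<xi>] by simp
  qed
  have approx: "\<exists>c\<in>C. ?F c A < a" if A: "A \<in> space M" and a: "?q A < a" for A a
  proof -
    interpret corrector_problem L X \<alpha>\<^sub>0 \<beta>\<^sub>0 A by (rule corrector_problem[OF A])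
    obtain \<psi> where \<psi>: "\<psi> \<in> X" and min: "?q A = energy_form L A (\<lambda>x. \<xi> + ?D \<psi> x) (\<lambda>x. \<xi> + ?D \<psi> x)"
      using Abar_attained[of \<xi>] by (elim bexE) (rule that)
    obtain c where "AE x in torus L. ?D \<psi> x = (\<Sum>b\<in>B. c b *\<^sub>R ?D b x)"
      using span[OF \<psi>] by (elim exE) (rule that)
    then have "AE x in torus L. \<xi> + ?D \<psi> x = u c x" by eventually_elim (simp add: u_def)
    then have qc: "?q A = ?F c A"
      unfolding min by (intro energy_form_cong_AE u L2_field_add L2_field_const weak_gradient_X \<psi>)
    have "\<exists>r. (\<forall>n. r n \<in> \<rat>) \<and> r \<longlonglongrightarrow> c b" for b
      using closure_sequential[of "c b" \<rat>] by (simp add: Rats_closure_real)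
    then obtain r where r: "\<And>b n. r b n \<in> \<rat>" "\<And>b. r b \<longlonglongrightarrow> c b" by metis
    define s where "s n = restrict (\<lambda>b. r b n) B" for n
    have s: "s n \<in> C" for n using r by (auto simp: s_def C_def)
    \<comment> \<open>The energy is a polynomial in the coefficients, so convergence of the
      coefficients carries over to it.\<close>
    have quad: "?F c A = energy_form L A (\<lambda>x. \<xi>) (\<lambda>x. \<xi>) + 2 * (\<Sum>b\<in>B. c b * energy_form L A (\<lambda>x. \<xi>) (?D b))
        + (\<Sum>b\<in>B. c b * (\<Sum>b'\<in>B. c b' * energy_form L A (?D b) (?D b')))" for c
      unfolding u_def
      by (simp add: energy_form_add_left energy_form_add_right L2_field_const S L2_field_add
          energy_form_sum_left energy_form_sum_right B(1) DB
          energy_form_sym[of "\<lambda>x. \<Sum>b\<in>B. c b *\<^sub>R ?D b x" "\<lambda>x. \<xi>"])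
    have "(\<lambda>n. s n b) \<longlonglongrightarrow> c b" if "b \<in> B" for b using r(2)[of b] that by (simp add: s_def)
    then have "(\<lambda>n. ?F (s n) A) \<longlonglongrightarrow> ?F c A"
      unfolding quad by (intro tendsto_intros) auto
    then have "\<forall>\<^sub>F n in sequentially. ?F (s n) A < a"
      by (rule order_tendstoD) (use a qc in simp)
    then obtain n where "?F (s n) A < a" by (meson eventually_happens' sequentially_bot)
    then show ?thesis using s by blast
  qed
  show ?thesis
    unfolding borel_measurable_iff_less
  proof
    fix a
    \<comment> \<open>A strict bound on the minimum already holds for a nearby rational competitor;
      conversely, no competitor lies below the minimum.\<close>
    have "{A \<in> space M. ?q A < a} = (\<Union>c\<in>C. {A \<in> space M. ?F c A < a})"
      using le approx by (auto intro: le_less_trans)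
    also have "\<dots> \<in> sets M"
    proof (rule sets.countable_UN''[OF C])
      have [measurable]: "(\<lambda>A. ?F c A) \<in> borel_measurable M" for c by (rule measurable_energy_form[OF u u])
      show "{A \<in> space M. ?F c A < a} \<in> sets M" for c by measurable
    qed
    finally show "{A \<in> space M. ?q A < a} \<in> sets M" .
  qed
qed

lemma measurable_Abar: "(\<lambda>A. \<eta> \<bullet> (Abar L X A *v \<xi>)) \<in> borel_measurable M"
proof -
  have "(\<lambda>A. ((\<eta> + \<xi>) \<bullet> (Abar L X A *v (\<eta> + \<xi>)) - (\<eta> - \<xi>) \<bullet> (Abar L X A *v (\<eta> - \<xi>))) / 4) \<in> borel_measurable M"
    by (intro borel_measurable_divide borel_measurable_diff measurable_quadratic_Abar borel_measurable_const)
  then show ?thesis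
    by (rule measurable_cong[THEN iffD2, rotated])
      (rule corrector_problem.Abar_polarization[OF corrector_problem])
qed

lemma bounded_Abar: "\<exists>C. \<forall>A\<in>space M. \<bar>\<eta> \<bullet> (Abar L X A *v \<xi>)\<bar> \<le> C"
  using corrector_problem.Abar_bound[OF corrector_problem] by (intro exI ballI)

end

section \<open>Covariances\<close>

lemma cov_commute: "cov M U V = cov M V U"
  by (simp add: cov_def mult.commute)

lemma cov_uminus_left: "cov M (\<lambda>\<omega>. - U \<omega>) V = - cov M U V"
proof -
  have "(- U \<omega> + integral\<^sup>L M U) * c = - ((U \<omega> - integral\<^sup>L M U) * c)" for \<omega> c
    by (simp add: algebra_simps)
  then show ?thesis by (simp add: cov_def)
qed

lemma cov_cong:
  assumes "\<And>\<omega>. \<omega> \<in> space M \<Longrightarrow> U \<omega> = U' \<omega>" "\<And>\<omega>. \<omega> \<in> space M \<Longrightarrow> V \<omega> = V' \<omega>"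
  shows "cov M U V = cov M U' V'"
proof -
  have "integral\<^sup>L M U = integral\<^sup>L M U'" "integral\<^sup>L M V = integral\<^sup>L M V'"
    using assms by (auto intro: Bochner_Integration.integral_cong)
  then show ?thesis
    unfolding cov_def using assms by (auto intro: Bochner_Integration.integral_cong)
qed

lemma cov_distr_invariant:
  assumes f: "f \<in> M \<rightarrow>\<^sub>M M" and inv: "distr M M f = M"
    and U: "U \<in> borel_measurable M" and V: "V \<in> borel_measurable M"
  shows "cov M (\<lambda>\<omega>. U (f \<omega>)) (\<lambda>\<omega>. V (f \<omega>)) = cov M U V"
proof -
  have int: "(LINT \<omega>|M. g (f \<omega>)) = integral\<^sup>L M g" if "g \<in> borel_measurable M" for g :: "'a \<Rightarrow> real"
    using integral_distr[OF f that] by (simp add: inv)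
  show ?thesis
    unfolding cov_def int[OF U] int[OF V]
    by (rule int) (intro borel_measurable_times borel_measurable_diff borel_measurable_const U V)
qed

text \<open>Bounded measurable functions are integrable on a probability space, so expectation may
  be exchanged with the finite sum.\<close>

lemma (in prob_space) cov_sum_left:
  assumes "finite I" "\<And>i. i \<in> I \<Longrightarrow> U i \<in> borel_measurable M" "V \<in> borel_measurable M"
    and "\<And>i. i \<in> I \<Longrightarrow> \<exists>C. \<forall>\<omega>\<in>space M. \<bar>U i \<omega>\<bar> \<le> C" "\<exists>C. \<forall>\<omega>\<in>space M. \<bar>V \<omega>\<bar> \<le> C"
  shows "cov M (\<lambda>\<omega>. \<Sum>i\<in>I. c i * U i \<omega>) V = (\<Sum>i\<in>I. c i * cov M (U i) V)"
proof -
  have int: "integrable M W" if W: "W \<in> borel_measurable M" "\<exists>C. \<forall>\<omega>\<in>space M. \<bar>W \<omega>\<bar> \<le> C" for W :: "'a \<Rightarrow> real"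
  proof -
    obtain C where "\<forall>\<omega>\<in>space M. \<bar>W \<omega>\<bar> \<le> C" using W(2) by blast
    then show ?thesis by (intro integrable_const_bound[of _ C] AE_I2 W(1)) auto
  qed
  let ?V = "\<lambda>\<omega>. V \<omega> - expectation V"
  have U: "integrable M (U i)" if "i \<in> I" for i using assms that by (intro int) auto
  have UV: "integrable M (\<lambda>\<omega>. (U i \<omega> - expectation (U i)) * ?V \<omega>)" if i: "i \<in> I" for i
  proof (rule int)
    show "(\<lambda>\<omega>. (U i \<omega> - expectation (U i)) * ?V \<omega>) \<in> borel_measurable M"
      using assms i by (intro borel_measurable_times borel_measurable_diff borel_measurable_const) auto
    obtain C D where C: "\<And>\<omega>. \<omega> \<in> space M \<Longrightarrow> \<bar>U i \<omega>\<bar> \<le> C" and D: "\<And>\<omega>. \<omega> \<in> space M \<Longrightarrow> \<bar>V \<omega>\<bar> \<le> D"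
      using assms(4)[OF i] assms(5) by blast
    have "\<bar>(U i \<omega> - expectation (U i)) * ?V \<omega>\<bar> \<le> (C + \<bar>expectation (U i)\<bar>) * (D + \<bar>expectation V\<bar>)"
      if "\<omega> \<in> space M" for \<omega>
      unfolding abs_mult
    proof (rule mult_mono)
      show "\<bar>U i \<omega> - expectation (U i)\<bar> \<le> C + \<bar>expectation (U i)\<bar>" using C[OF that] by linarith
      show "\<bar>?V \<omega>\<bar> \<le> D + \<bar>expectation V\<bar>" using D[OF that] by linarith
      show "0 \<le> C + \<bar>expectation (U i)\<bar>" using C[OF that] by linarith
    qed simp
    then show "\<exists>C. \<forall>\<omega>\<in>space M. \<bar>(U i \<omega> - expectation (U i)) * ?V \<omega>\<bar> \<le> C" by blast
  qed
  have "expectation (\<lambda>\<omega>. \<Sum>i\<in>I. c i * U i \<omega>) = (\<Sum>i\<in>I. c i * expectation (U i))"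
    using U by (simp add: Bochner_Integration.integral_sum)
  then have "(\<Sum>i\<in>I. c i * U i \<omega>) - expectation (\<lambda>\<omega>. \<Sum>i\<in>I. c i * U i \<omega>)
      = (\<Sum>i\<in>I. c i * (U i \<omega> - expectation (U i)))" for \<omega>
    by (simp add: sum_subtractf right_diff_distrib)
  then have "cov M (\<lambda>\<omega>. \<Sum>i\<in>I. c i * U i \<omega>) V
      = expectation (\<lambda>\<omega>. (\<Sum>i\<in>I. c i * ((U i \<omega> - expectation (U i)) * ?V \<omega>)))"
    by (simp add: cov_def sum_distrib_right mult.assoc)
  also have "\<dots> = (\<Sum>i\<in>I. c i * cov M (U i) V)"
    using UV by (simp add: Bochner_Integration.integral_sum cov_def)
  finally show ?thesis .
qed

section \<open>Symmetries and four-linearity of \<open>Qbar\<close>\<close>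

context random_corrector
begin

lemma Qbar_swap_first: "Qbar L M X \<eta> \<xi> \<eta>' \<xi>' = Qbar L M X \<xi> \<eta> \<eta>' \<xi>'"
  unfolding Qbar_def
  by (rule arg_cong, rule cov_cong) (rule corrector_problem.Abar_symmetric_inner[OF corrector_problem], auto)

lemma Qbar_commute: "Qbar L M X \<eta> \<xi> \<eta>' \<xi>' = Qbar L M X \<eta>' \<xi>' \<eta> \<xi>"
  unfolding Qbar_def by (subst cov_commute) simp

lemma Qbar_swap_last: "Qbar L M X \<eta> \<xi> \<eta>' \<xi>' = Qbar L M X \<eta> \<xi> \<xi>' \<eta>'"
  by (metis Qbar_commute Qbar_swap_first)

lemma Qbar_uminus:
  "Qbar L M X (- \<eta>) \<xi> \<eta>' \<xi>' = - Qbar L M X \<eta> \<xi> \<eta>' \<xi>'"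
  by (simp add: Qbar_def cov_uminus_left)

lemma Qbar_expand_left:
  "Qbar L M X \<eta> \<xi> \<eta>' \<xi>' = (\<Sum>i\<in>UNIV. \<Sum>j\<in>UNIV. \<eta> $ i * \<xi> $ j * Qbar L M X (axis i 1) (axis j 1) \<eta>' \<xi>')"
proof -
  interpret prob_space M using ens by (simp add: ensemble_def)
  have entry: "B $ i $ j = axis i 1 \<bullet> (B *v axis j 1)" for B :: "real^'d^'d" and i j
    by (simp add: inner_axis' matrix_vector_mul_component inner_axis)
  \<comment> \<open>Indexing by pairs turns the double sum over matrix entries into a single finite
    sum, the form that \<open>cov_sum_left\<close> expects.\<close>
  have "cov M (\<lambda>A. \<eta> \<bullet> (Abar L X A *v \<xi>)) (\<lambda>A. \<eta>' \<bullet> (Abar L X A *v \<xi>'))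
      = cov M (\<lambda>A. \<Sum>k\<in>UNIV. \<eta> $ fst k * \<xi> $ snd k * (axis (fst k) 1 \<bullet> (Abar L X A *v axis (snd k) 1)))
          (\<lambda>A. \<eta>' \<bullet> (Abar L X A *v \<xi>'))"
    by (simp add: inner_matrix_vector_expand[of \<eta>] entry sum.cartesian_product case_prod_unfold)
  also have "\<dots> = (\<Sum>k\<in>UNIV. \<eta> $ fst k * \<xi> $ snd k * cov M (\<lambda>A. axis (fst k) 1 \<bullet> (Abar L X A *v axis (snd k) 1))
          (\<lambda>A. \<eta>' \<bullet> (Abar L X A *v \<xi>')))"
    by (rule cov_sum_left) (auto intro: measurable_Abar bounded_Abar)
  also have "\<dots> = (\<Sum>i\<in>UNIV. \<Sum>j\<in>UNIV. \<eta> $ i * \<xi> $ j * cov M (\<lambda>A. axis i 1 \<bullet> (Abar L X A *v axis j 1))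
          (\<lambda>A. \<eta>' \<bullet> (Abar L X A *v \<xi>')))"
    by (simp add: sum.cartesian_product case_prod_unfold)
  finally show ?thesis by (simp add: Qbar_def sum_distrib_left mult_ac)
qed

text \<open>Commutativity of the covariance turns the expansion in the first two arguments into one
  in the last two.\<close>

lemma Qbar_expand:
  "Qbar L M X \<eta> \<xi> \<eta>' \<xi>' = (\<Sum>i\<in>UNIV. \<Sum>j\<in>UNIV. \<Sum>k\<in>UNIV. \<Sum>l\<in>UNIV.
    \<eta> $ i * \<xi> $ j * \<eta>' $ k * \<xi>' $ l * Qbar L M X (axis i 1) (axis j 1) (axis k 1) (axis l 1))"
proof -
  have "Qbar L M X (axis i 1) (axis j 1) \<eta>' \<xi>' = (\<Sum>k\<in>UNIV. \<Sum>l\<in>UNIV.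
      \<eta>' $ k * \<xi>' $ l * Qbar L M X (axis i 1) (axis j 1) (axis k 1) (axis l 1))" for i j
    using Qbar_expand_left[of \<eta>' \<xi>' "axis i 1" "axis j 1"]
    by (simp add: Qbar_commute[of _ _ "axis i 1" "axis j 1"])
  then show ?thesis
    by (subst Qbar_expand_left) (simp add: sum_distrib_left mult_ac)
qed

lemma Qbar_rotate:
  assumes R: "R \<in> cube_group" and inv: "cube_invariant M"
    and X: "\<And>R \<psi>. R \<in> cube_group \<Longrightarrow> \<psi> \<in> X \<Longrightarrow> (\<lambda>x. \<psi> (R *v x)) \<in> X"
  shows "Qbar L M X (R *v \<eta>) (R *v \<xi>) (R *v \<eta>') (R *v \<xi>') = Qbar L M X \<eta> \<xi> \<eta>' \<xi>'"
proof -
  have rot: "(R *v \<eta>) \<bullet> (Abar L X A *v (R *v \<xi>)) = \<eta> \<bullet> (Abar L X (rotate_field R A) *v \<xi>)"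
    if A: "A \<in> space M" for A \<eta> \<xi>
  proof -
    interpret corrector_problem L X \<alpha>\<^sub>0 \<beta>\<^sub>0 A by (rule corrector_problem[OF A])
    interpret invariant_corrector_problem L X \<alpha>\<^sub>0 \<beta>\<^sub>0 A by unfold_locales (rule X)
    show ?thesis by (rule Abar_rotate[OF R, symmetric])
  qed
  have "distr M M (rotate_field R) = M"
    using inv R by (simp add: cube_invariant_def rotate_field_def[abs_def])
  then have "cov M (\<lambda>A. \<eta> \<bullet> (Abar L X (rotate_field R A) *v \<xi>)) (\<lambda>A. \<eta>' \<bullet> (Abar L X (rotate_field R A) *v \<xi>'))
      = cov M (\<lambda>A. \<eta> \<bullet> (Abar L X A *v \<xi>)) (\<lambda>A. \<eta>' \<bullet> (Abar L X A *v \<xi>'))"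
    by (rule cov_distr_invariant[OF measurable_rotate_field[OF R] _ measurable_Abar measurable_Abar])
  moreover have "cov M (\<lambda>A. (R *v \<eta>) \<bullet> (Abar L X A *v (R *v \<xi>))) (\<lambda>A. (R *v \<eta>') \<bullet> (Abar L X A *v (R *v \<xi>')))
      = cov M (\<lambda>A. \<eta> \<bullet> (Abar L X (rotate_field R A) *v \<xi>)) (\<lambda>A. \<eta>' \<bullet> (Abar L X (rotate_field R A) *v \<xi>'))"
    by (rule cov_cong) (rule rot; assumption)+
  ultimately show ?thesis by (simp add: Qbar_def)
qed

end

section \<open>Reflections and exchanges of axes\<close>

lemma involution_in_cube_group:
  fixes R :: "real^'d^'d"
  assumes "transpose R = R" "R ** R = mat 1" "\<And>x. x \<in> cbox (- 1) 1 \<Longrightarrow> R *v x \<in> cbox (- 1) 1"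
  shows "R \<in> cube_group"
proof -
  \<comment> \<open>An involution that maps the cube into itself maps it onto itself, every point
    being the image of its image.\<close>
  have "R *v (R *v x) = x" for x using assms(2) by (simp add: matrix_vector_mul_assoc)
  then have "x \<in> (\<lambda>x. R *v x) ` cbox (- 1) 1" if "x \<in> cbox (- 1) 1" for x
    using assms(3)[OF that] by (metis image_eqI)
  then have "(\<lambda>x. R *v x) ` cbox (- 1) 1 = cbox (- 1) 1" using assms(3) by blast
  then show ?thesis using assms by (simp add: cube_group_def orthogonal_matrix_def)
qed

definition reflection :: "'d \<Rightarrow> real^'d^'d"
  where "reflection a = (\<chi> i j. if i = j then if i = a then -1 else 1 else 0)"

lemma reflection_apply: "(reflection a *v x) $ i = (if i = a then - x $ i else x $ i)"
  by (simp add: reflection_def matrix_vector_mult_def if_distrib[of "\<lambda>c. c * _"] cong: if_cong)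

lemma reflection_in_cube_group: "reflection a \<in> cube_group"
proof (rule involution_in_cube_group)
  show "transpose (reflection a) = reflection a"
    by (auto simp: reflection_def transpose_def vec_eq_iff)
  show "reflection a ** reflection a = mat 1"
    by (subst matrix_eq) (simp add: vec_eq_iff reflection_apply flip: matrix_vector_mul_assoc)
qed (auto simp: mem_box_cart reflection_apply minus_le_iff)

lemma reflection_axis: "reflection a *v axis i 1 = (if i = a then - axis i 1 else axis i 1)"
  by (auto simp: vec_eq_iff reflection_apply axis_def)

text \<open>\<open>Transposition.transpose a b\<close> exchanges the indices \<open>a\<close> and
  \<open>b\<close>; it is not the transpose of a matrix.\<close>

definition transposition :: "'d \<Rightarrow> 'd \<Rightarrow> real^'d^'d"
  where "transposition a b = (\<chi> i j. of_bool (j = Transposition.transpose a b i))"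

lemma transposition_apply: "(transposition a b *v x) $ i = x $ Transposition.transpose a b i"
  by (simp add: transposition_def matrix_vector_mult_def)

lemma transposition_in_cube_group: "transposition a b \<in> cube_group"
proof (rule involution_in_cube_group)
  show "Finite_Cartesian_Product.transpose (transposition a b) = transposition a b"
    by (auto simp: transposition_def Finite_Cartesian_Product.transpose_def vec_eq_iff of_bool_def)
  show "transposition a b ** transposition a b = mat 1"
    by (subst matrix_eq) (simp add: vec_eq_iff transposition_apply flip: matrix_vector_mul_assoc)
qed (auto simp: mem_box_cart transposition_apply)

lemma transposition_axis: "transposition a b *v axis i 1 = axis (Transposition.transpose a b i) 1"
  by (auto simp: vec_eq_iff transposition_apply axis_def)

theorem mainTheorem1:
  fixes L :: nat and \<alpha>\<^sub>0 \<beta>\<^sub>0 :: real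
    and M :: "(real^'d \<Rightarrow> real^'d^'d) measure"
    and X :: "(real^'d \<Rightarrow> real) set"
  assumes "CARD('d) \<ge> 2" and "L \<ge> 1" and "0 < \<alpha>\<^sub>0" and "\<alpha>\<^sub>0 \<le> \<beta>\<^sub>0"
    and "ensemble L \<alpha>\<^sub>0 \<beta>\<^sub>0 M" and "stationary M" and "cube_invariant M"
    and "finite_dim_torus_space L X"
    and "\<forall>R\<in>cube_group. \<forall>\<psi>\<in>X. (\<lambda>x. \<psi> (R *v x)) \<in> X"
  shows "(\<forall>R\<in>cube_group. \<forall>\<eta> \<xi> \<eta>' \<xi>'.
            Qbar L M X (R *v \<eta>) (R *v \<xi>) (R *v \<eta>') (R *v \<xi>') = Qbar L M X \<eta> \<xi> \<eta>' \<xi>')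
    \<and> (CARD('d) = 2 \<longrightarrow> (\<forall>a b :: 'd. a \<noteq> b \<longrightarrow>
        (let e\<^sub>1 = axis a 1; e\<^sub>2 = axis b 1; Q = Qbar L M X in
          Q e\<^sub>1 e\<^sub>1 e\<^sub>1 e\<^sub>2 = 0 \<and> Q e\<^sub>1 e\<^sub>1 e\<^sub>2 e\<^sub>1 = 0 \<and> Q e\<^sub>1 e\<^sub>2 e\<^sub>1 e\<^sub>1 = 0 \<and> Q e\<^sub>2 e\<^sub>1 e\<^sub>1 e\<^sub>1 = 0
        \<and> Q e\<^sub>1 e\<^sub>2 e\<^sub>2 e\<^sub>2 = 0 \<and> Q e\<^sub>2 e\<^sub>1 e\<^sub>2 e\<^sub>2 = 0 \<and> Q e\<^sub>2 e\<^sub>2 e\<^sub>1 e\<^sub>2 = 0 \<and> Q e\<^sub>2 e\<^sub>2 e\<^sub>2 e\<^sub>1 = 0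
        \<and> Q e\<^sub>1 e\<^sub>2 e\<^sub>1 e\<^sub>2 = Q e\<^sub>1 e\<^sub>2 e\<^sub>2 e\<^sub>1 \<and> Q e\<^sub>1 e\<^sub>2 e\<^sub>2 e\<^sub>1 = Q e\<^sub>2 e\<^sub>1 e\<^sub>1 e\<^sub>2
        \<and> Q e\<^sub>2 e\<^sub>1 e\<^sub>1 e\<^sub>2 = Q e\<^sub>2 e\<^sub>1 e\<^sub>2 e\<^sub>1
        \<and> Q e\<^sub>1 e\<^sub>1 e\<^sub>2 e\<^sub>2 = Q e\<^sub>2 e\<^sub>2 e\<^sub>1 e\<^sub>1
        \<and> Q e\<^sub>1 e\<^sub>1 e\<^sub>1 e\<^sub>1 = Q e\<^sub>2 e\<^sub>2 e\<^sub>2 e\<^sub>2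
        \<and> (\<forall>\<eta> \<xi> \<eta>' \<xi>'. Q \<eta> \<xi> \<eta>' \<xi>' =
              Q e\<^sub>1 e\<^sub>1 e\<^sub>1 e\<^sub>1 * (\<eta>$a * \<xi>$a * \<eta>'$a * \<xi>'$a + \<eta>$b * \<xi>$b * \<eta>'$b * \<xi>'$b)
            + Q e\<^sub>1 e\<^sub>1 e\<^sub>2 e\<^sub>2 * (\<eta>$a * \<xi>$a * \<eta>'$b * \<xi>'$b + \<eta>$b * \<xi>$b * \<eta>'$a * \<xi>'$a)
            + Q e\<^sub>1 e\<^sub>2 e\<^sub>1 e\<^sub>2 * ((\<eta>$a * \<xi>$b + \<eta>$b * \<xi>$a) * (\<eta>'$a * \<xi>'$b + \<eta>'$b * \<xi>'$a))))))"
proof -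
  have X_inv: "(\<lambda>x. \<psi> (R *v x)) \<in> X" if "R \<in> cube_group" "\<psi> \<in> X" for R \<psi>
    using assms(9)[THEN bspec, OF that(1), THEN bspec, OF that(2)] .
  interpret random_corrector L X \<alpha>\<^sub>0 \<beta>\<^sub>0 M
    by unfold_locales (fact assms)+
  let ?Q = "Qbar L M X"
  have rot: "?Q (R *v \<eta>) (R *v \<xi>) (R *v \<eta>') (R *v \<xi>') = ?Q \<eta> \<xi> \<eta>' \<xi>'"
    if "R \<in> cube_group" for R \<eta> \<xi> \<eta>' \<xi>'
    by (rule Qbar_rotate[OF that assms(7) X_inv])
  have planar: "let e\<^sub>1 = axis a 1; e\<^sub>2 = axis b 1; Q = Qbar L M X in
          Q e\<^sub>1 e\<^sub>1 e\<^sub>1 e\<^sub>2 = 0 \<and> Q e\<^sub>1 e\<^sub>1 e\<^sub>2 e\<^sub>1 = 0 \<and> Q e\<^sub>1 e\<^sub>2 e\<^sub>1 e\<^sub>1 = 0 \<and> Q e\<^sub>2 e\<^sub>1 e\<^sub>1 e\<^sub>1 = 0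
        \<and> Q e\<^sub>1 e\<^sub>2 e\<^sub>2 e\<^sub>2 = 0 \<and> Q e\<^sub>2 e\<^sub>1 e\<^sub>2 e\<^sub>2 = 0 \<and> Q e\<^sub>2 e\<^sub>2 e\<^sub>1 e\<^sub>2 = 0 \<and> Q e\<^sub>2 e\<^sub>2 e\<^sub>2 e\<^sub>1 = 0
        \<and> Q e\<^sub>1 e\<^sub>2 e\<^sub>1 e\<^sub>2 = Q e\<^sub>1 e\<^sub>2 e\<^sub>2 e\<^sub>1 \<and> Q e\<^sub>1 e\<^sub>2 e\<^sub>2 e\<^sub>1 = Q e\<^sub>2 e\<^sub>1 e\<^sub>1 e\<^sub>2
        \<and> Q e\<^sub>2 e\<^sub>1 e\<^sub>1 e\<^sub>2 = Q e\<^sub>2 e\<^sub>1 e\<^sub>2 e\<^sub>1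
        \<and> Q e\<^sub>1 e\<^sub>1 e\<^sub>2 e\<^sub>2 = Q e\<^sub>2 e\<^sub>2 e\<^sub>1 e\<^sub>1
        \<and> Q e\<^sub>1 e\<^sub>1 e\<^sub>1 e\<^sub>1 = Q e\<^sub>2 e\<^sub>2 e\<^sub>2 e\<^sub>2
        \<and> (\<forall>\<eta> \<xi> \<eta>' \<xi>'. Q \<eta> \<xi> \<eta>' \<xi>' =
              Q e\<^sub>1 e\<^sub>1 e\<^sub>1 e\<^sub>1 * (\<eta>$a * \<xi>$a * \<eta>'$a * \<xi>'$a + \<eta>$b * \<xi>$b * \<eta>'$b * \<xi>'$b)
            + Q e\<^sub>1 e\<^sub>1 e\<^sub>2 e\<^sub>2 * (\<eta>$a * \<xi>$a * \<eta>'$b * \<xi>'$b + \<eta>$b * \<xi>$b * \<eta>'$a * \<xi>'$a)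
            + Q e\<^sub>1 e\<^sub>2 e\<^sub>1 e\<^sub>2 * ((\<eta>$a * \<xi>$b + \<eta>$b * \<xi>$a) * (\<eta>'$a * \<xi>'$b + \<eta>'$b * \<xi>'$a)))"
    if d: "CARD('d) = 2" and ab: "a \<noteq> b" for a b :: 'd
  proof -
    have "{a, b} = UNIV" using d ab by (intro card_subset_eq) auto
    then have UN: "(\<Sum>i\<in>UNIV. h i) = h a + h b" for h :: "'d \<Rightarrow> real"
      using ab by (metis sum.insert sum.empty finite.intros empty_iff insert_iff add.right_neutral)
    let ?q = "\<lambda>i j k l. ?Q (axis i 1) (axis j 1) (axis k 1) (axis l 1)"
    \<comment> \<open>Reflecting axis \<open>i\<close> changes the sign of exactly one argument, so
      the value equals its negative.\<close>
    have odd: "?q i j j j = 0" if "i \<noteq> j" for i j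
      using rot[OF reflection_in_cube_group[of i], of "axis i 1" "axis j 1" "axis j 1" "axis j 1"] that
      by (simp add: reflection_axis Qbar_uminus)
    have odd2: "?q j i j j = 0" "?q j j i j = 0" "?q j j j i = 0" if "i \<noteq> j" for i j
      using odd[OF that] Qbar_swap_first[of "axis j 1" "axis i 1" "axis j 1" "axis j 1"]
        Qbar_commute[of "axis j 1" "axis j 1" "axis i 1" "axis j 1"]
        Qbar_swap_last[of "axis j 1" "axis j 1" "axis j 1" "axis i 1"]
      by simp_all
    \<comment> \<open>The symmetry of \<open>Abar\<close> exchanges the arguments within each
      pair.\<close>
    have shear: "?q a b b a = ?q a b a b" "?q b a a b = ?q a b a b" "?q b a b a = ?q a b a b"
      using Qbar_swap_last[of "axis a 1" "axis b 1" "axis b 1" "axis a 1"]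
        Qbar_swap_first[of "axis b 1" "axis a 1" "axis a 1" "axis b 1"]
        Qbar_swap_first[of "axis b 1" "axis a 1" "axis b 1" "axis a 1"]
      by simp_all
    \<comment> \<open>This comes from the symmetry of the covariance rather than from a
      rotation.\<close>
    have mixed: "?q b b a a = ?q a a b b" by (rule Qbar_commute)
    have pure: "?q b b b b = ?q a a a a"
      using rot[OF transposition_in_cube_group[of a b], of "axis a 1" "axis a 1" "axis a 1" "axis a 1"]
      by (simp add: transposition_axis)
    have expand: "?Q \<eta> \<xi> \<eta>' \<xi>' =
              ?q a a a a * (\<eta>$a * \<xi>$a * \<eta>'$a * \<xi>'$a + \<eta>$b * \<xi>$b * \<eta>'$b * \<xi>'$b)
            + ?q a a b b * (\<eta>$a * \<xi>$a * \<eta>'$b * \<xi>'$b + \<eta>$b * \<xi>$b * \<eta>'$a * \<xi>'$a)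
            + ?q a b a b * ((\<eta>$a * \<xi>$b + \<eta>$b * \<xi>$a) * (\<eta>'$a * \<xi>'$b + \<eta>'$b * \<xi>'$a))" for \<eta> \<xi> \<eta>' \<xi>'
      \<comment> \<open>Of the sixteen terms eight vanish; the others are two pure, two mixed and
        four shear terms.\<close>
      unfolding Qbar_expand[of \<eta> \<xi> \<eta>' \<xi>'] UN
      using ab by (simp add: odd odd2 shear mixed pure) (simp add: algebra_simps)
    show ?thesis
      unfolding Let_def
      by (intro conjI allI; (rule expand | simp add: ab ab[symmetric] odd odd2 shear mixed pure))
  qed
  show ?thesis
    by (intro conjI ballI allI impI) (rule rot planar; assumption)+
qed

end
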